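(* Under the local alternatives $K_{(n)}: H\beta=h+n^{-1/2}\xi$ and the regularity assumptions (A1), (A2) (model, estimators, statistics and assumptions as in the context), suppose $\lambda_n=o(n^{1/2})$. Let $k=q-2$, $$\delta=C^{-1}H^T(HC^{-1}H^T)^{-1}\xi,\qquad A=C^{-1}-C^{-1}H^T(HC^{-1}H^T)^{-1}HC^{-1},$$ $$\mathcal{L}=\sigma^{-2}(HW+\xi)^T(HC^{-1}H^T)^{-1}(HW+\xi),$$ with $W$ as in (i). Then, as $n\to\infty$ (with $\overset{\mathcal D}{\to}$ convergence in distribution and $\overset{\mathcal D}{=}$ equality in distribution): (i) $W=\sqrt n(\tilde\beta_n-\beta)\overset{\mathcal D}{\to}N_p(0,\sigma^2C^{-1})$. (ii) $W_n^{(1)}=\sqrt n(\hat\beta_n^L-\beta)\overset{\mathcal D}{\to}N_p(0,\sigma^2C^{-1})$, i.e. $W_n^{(1)}\overset{\mathcal D}{=}W$. (iii) $W_n^{(2)}=\sqrt n(\hat\beta_n^{RL}-\beta)\overset{\mathcal D}{\to}N_p(-\delta,\sigma^2A)$. (iv) $W_n^{(3)}=\sqrt n(\hat\beta_n^L-\hat\beta_n^{RL})\overset{\mathcal D}{\to}N_p(\delta,\sigma^2(C^{-1}-A))$. (v) $W_n^{(4)}=H\hat\beta_n^L-h\overset{\mathcal D}{\to}N_q(H\beta-h,\sigma^2(HC^{-1}H^T))$. (vi) $\begin{bmatrix} W_n^{(1)} \\ W_n^{(3)} \end{bmatrix}\overset{\mathcal D}{\to}N_{2p}\left(\begin{bmatrix}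 0 \\ \delta \end{bmatrix},\sigma^2\begin{bmatrix} C^{-1} & C^{-1}-A \\ C^{-1}-A & C^{-1}-A \end{bmatrix}\right)$. (vii) $\begin{bmatrix} W_n^{(2)} \\ W_n^{(3)} \end{bmatrix}\overset{\mathcal D}{\to}N_{2p}\left(\begin{bmatrix} -\delta \\ \delta \end{bmatrix},\sigma^2\begin{bmatrix} A & 0 \\ 0 & C^{-1}-A \end{bmatrix}\right)$. (viii) $\begin{bmatrix} W_n^{(1)} \\ W_n^{(4)} \end{bmatrix}\overset{\mathcal D}{\to}N_{p+q}\left(\begin{bmatrix} 0 \\ H\beta-h \end{bmatrix},\sigma^2\begin{bmatrix} C^{-1} & C^{-1}H^T \\ HC^{-1} & HC^{-1}H^T \end{bmatrix}\right)$. (ix) $\sqrt n(\hat\beta_n^{SSL}-\beta)\overset{\mathcal D}{=}W-k\left\{\dfrac{C^{-1}H^T(HC^{-1}H^T)^{-1}(HW+\xi)}{\sigma^{-2}(HW+\xi)^T(HC^{-1}H^T)^{-1}(HW+\xi)}\right\}$. (x) $$\sqrt n(\hat\beta_n^{PRSSL}-\beta)\overset{\mathcal D}{=}W-k\left\{\frac{C^{-1}H^T(HC^{-1}H^T)^{-1}(HW+\xi)}{\sigma^{-2}(HW+\xi)^T(HC^{-1}H^T)^{-1}(HW+\xi)}\right\}-C^{-1}H^T(HC^{-1}H^T)^{-1}(HW+\xi)\left\{1-\frac{k}{\sigma^{-2}(HW+\xi)^T(HC^{-1}H^T)^{-1}(HW+\xi)}\right\}I(\mathcal{L}<k).$$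
   Context: Model: $Y_n=X_n\beta+\epsilon_n$, where $\beta\in\mathbb{R}^p$ is an unknown vector, $X_n$ is a given $n\times p$ design matrix of full rank with rows $x_1^T,\dots,x_n^T$, and $E(\epsilon_n)=0$, $E(\epsilon_n\epsilon_n^T)=\sigma^2I_n$ with $\sigma^2<\infty$. Put $C_n=X_n^TX_n$. OLS: $\tilde\beta_n=C_n^{-1}X_n^TY_n$, $m=n-p$, $s_e^2=m^{-1}(Y_n-X_n\tilde\beta_n)^T(Y_n-X_n\tilde\beta_n)$. It is taken that $\tilde\beta_n\sim N_p(\beta,\sigma^2C_n^{-1})$, independent of $ms_e^2/\sigma^2$, which is central chi-squared with $m$ degrees of freedom. Regularity assumptions: (A1) $\max_{1\le i\le n}x_i^TC_n^{-1}x_i\to0$ as $n\to\infty$; (A2) $\lim_{n\to\infty}n^{-1}C_n=C$, where $C$ is finite and positive definite. Restriction: $H$ is a known $q\times p$ matrix of rank $q\le p$, $h$ is a known $q\times1$ vector, and the null hypothesis is $\mathcal{H}_o: H\beta=h$. The local alternatives are $K_{(n)}: H\beta=h+n^{-1/2}\xi$ with $\xi\in\mathbb{R}^q$. LASSO: $\hat\beta_n^L=\operatorname{argmin}_{b\in\mathbb{R}^p}\{\sum_{i=1}^n(Y_i-x_i^Tb)^2+\lambda_n\sum_{j=1}^p|b_j|\}$, $\lambda_n\ge0$. Restricted LASSO: $\hat\beta_n^{RL}=\hat\beta_n^L-C_n^{-1}H^T(HC_n^{-1}H^T)^{-1}(H\hat\beta_n^L-h)$. Test statistic: $\mathcal{L}_n=s_e^{-2}(H\tilde\beta_n-h)^T(HC_n^{-1}H^T)^{-1}(H\tilde\beta_n-h)$.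 Stein-type shrinkage LASSO: $\hat\beta_n^{SSL}=\hat\beta_n^L-k_n(\hat\beta_n^L-\hat\beta_n^{RL})\mathcal{L}_n^{-1}$, with $k_n=m(q-2)/(m+2)$. Positive-rule Stein-type shrinkage LASSO: $\hat\beta_n^{PRSSL}=\hat\beta_n^{RL}+(1-k_n\mathcal{L}_n^{-1})I(\mathcal{L}_n>k_n)(\hat\beta_n^L-\hat\beta_n^{RL})$. $I(\cdot)$ is the indicator function.
   Formalization: In (v) and (viii), W_n^(4) is taken as √n(Hβ̂_n^L − h) with limiting mean ξ = √n(Hβ − h), since without √n it tends to 0 and the stated limit is false; β may depend on n so that the local alternatives hold for every n; "=D" in (ix), (x) is convergence in distribution. *)

theory Defs
  imports "HOL-Probability.Probability" "HOL-Library.Landau_Symbols"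
begin

definition pos_def :: "real^'d^'d \<Rightarrow> bool" where
  "pos_def S \<longleftrightarrow> transpose S = S \<and> (\<forall>v. v \<noteq> 0 \<longrightarrow> 0 < v \<bullet> (S *v v))"

definition block_vec :: "real^'a \<Rightarrow> real^'b \<Rightarrow> real^('a + 'b)" where
  "block_vec u v = (\<chi> i. case i of Inl a \<Rightarrow> u $ a | Inr b \<Rightarrow> v $ b)"

definition block_mat ::
  "real^'c^'a \<Rightarrow> real^'d^'a \<Rightarrow> real^'c^'b \<Rightarrow> real^'d^'b \<Rightarrow> real^('c + 'd)^('a + 'b)" where
  "block_mat P Q R S = (\<chi> i j.
     case i of
       Inl a \<Rightarrow> (case j of Inl c \<Rightarrow> P $ a $ c | Inr d \<Rightarrow> Q $ a $ d)
     | Inr b \<Rightarrow> (case j of Inl c \<Rightarrow> R $ b $ c | Inr d \<Rightarrow> S $ b $ d))"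

definition normal_measure :: "real \<Rightarrow> real \<Rightarrow> real measure" where
  "normal_measure \<mu> v =
     (if v = 0 then return borel \<mu>
      else density lborel (\<lambda>x. ennreal (normal_density \<mu> (sqrt v) x)))"

text \<open>
  A law is multivariate normal with mean vector \<open>\<mu>\<close> and covariance matrix \<open>S\<close> iff every linear
  functional is univariate normal with the corresponding mean and variance. The covariance matrix
  may be singular (then some functionals are point masses). The case of the
  zero functional forces the total mass to be 1.
\<close>

definition normal_law :: "real^'d \<Rightarrow> real^'d^'d \<Rightarrow> (real^'d) measure \<Rightarrow> bool" where
  "normal_law \<mu> S N \<longleftrightarrow>
     transpose S = S \<and> (\<forall>t. 0 \<le> t \<bullet> (S *v t)) \<and> sets N = sets borel \<and>
     (\<forall>t. distr N borel (\<lambda>x. t \<bullet> x) = normal_measure (t \<bullet> \<mu>) (t \<bullet> (S *v t)))"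

definition chi_square_density :: "nat \<Rightarrow> real \<Rightarrow> real" where
  "chi_square_density m x =
     (if x \<le> 0 then 0
      else x powr (real m / 2 - 1) * exp (- x / 2) / (2 powr (real m / 2) * Gamma (real m / 2)))"

text \<open>The library's \<open>indep_var\<close> forces both variables to have values in the same type.\<close>

definition indep_rv ::
  "'w measure \<Rightarrow> ('w \<Rightarrow> 'b::topological_space) \<Rightarrow> ('w \<Rightarrow> 'c::topological_space) \<Rightarrow> bool" where
  "indep_rv P U V \<longleftrightarrow>
     prob_space.indep_set P {U -` B \<inter> space P | B. B \<in> sets borel}
                            {V -` B \<inter> space P | B. B \<in> sets borel}"

text \<open>
  The \<open>n\<close>-th variable lives on its own probability space \<open>M n\<close>. Measurability is only required for
  large \<open>n\<close>, because the estimators below are meaningful only once \<open>n\<close> exceeds the number of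
  regressors.
\<close>

definition conv_in_dist ::
  "(nat \<Rightarrow> 'w measure) \<Rightarrow> (nat \<Rightarrow> 'w \<Rightarrow> 'b::euclidean_space) \<Rightarrow> 'b measure \<Rightarrow> bool" where
  "conv_in_dist M Z N \<longleftrightarrow>
     (\<forall>\<^sub>F n in sequentially. Z n \<in> borel_measurable (M n)) \<and>
     (\<forall>f :: 'b \<Rightarrow> real. continuous_on UNIV f \<and> bounded (range f) \<longrightarrow>
        (\<lambda>n. \<integral>\<omega>. f (Z n \<omega>) \<partial>M n) \<longlonglongrightarrow> (\<integral>z. f z \<partial>N))"

definition conv_normal ::
  "(nat \<Rightarrow> 'w measure) \<Rightarrow> (nat \<Rightarrow> 'w \<Rightarrow> real^'d) \<Rightarrow> real^'d \<Rightarrow> real^'d^'d \<Rightarrow> bool" where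
  "conv_normal M Z \<mu> S \<longleftrightarrow> (\<exists>N. normal_law \<mu> S N \<and> conv_in_dist M Z N)"

text \<open>
  The design matrix with \<open>n\<close> rows is given by its rows \<open>x i\<close>, and the response vector by its entries
  \<open>y i\<close>, for \<open>i\<close> in \<open>{1..n}\<close>; other indices are ignored.
\<close>

definition gram :: "nat \<Rightarrow> (nat \<Rightarrow> real^'p) \<Rightarrow> real^'p^'p" where
  "gram n x = (\<chi> j k. \<Sum>i\<in>{1..n}. x i $ j * x i $ k)"

definition ols :: "nat \<Rightarrow> (nat \<Rightarrow> real^'p) \<Rightarrow> (nat \<Rightarrow> real) \<Rightarrow> real^'p" where
  "ols n x y = matrix_inv (gram n x) *v (\<Sum>i\<in>{1..n}. y i *\<^sub>R x i)"

definition resid_var :: "nat \<Rightarrow> (nat \<Rightarrow> real^'p) \<Rightarrow> (nat \<Rightarrow> real) \<Rightarrow> real" where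
  "resid_var n x y =
     (\<Sum>i\<in>{1..n}. (y i - x i \<bullet> ols n x y)\<^sup>2) / (real n - real CARD('p))"

definition lasso_obj :: "nat \<Rightarrow> (nat \<Rightarrow> real^'p) \<Rightarrow> (nat \<Rightarrow> real) \<Rightarrow> real \<Rightarrow> real^'p \<Rightarrow> real" where
  "lasso_obj n x y l b =
     (\<Sum>i\<in>{1..n}. (y i - x i \<bullet> b)\<^sup>2) + l * (\<Sum>j\<in>UNIV. \<bar>b $ j\<bar>)"

definition lasso :: "nat \<Rightarrow> (nat \<Rightarrow> real^'p) \<Rightarrow> (nat \<Rightarrow> real) \<Rightarrow> real \<Rightarrow> real^'p" where
  "lasso n x y l = arg_min (lasso_obj n x y l) (\<lambda>_. True)"

definition restricted_lasso ::
  "nat \<Rightarrow> (nat \<Rightarrow> real^'p) \<Rightarrow> (nat \<Rightarrow> real) \<Rightarrow> real \<Rightarrow> real^'p^'q \<Rightarrow> real^'q \<Rightarrow> real^'p" where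
  "restricted_lasso n x y l H h =
     (let Ci = matrix_inv (gram n x); b = lasso n x y l in
      b - (Ci ** transpose H ** matrix_inv (H ** Ci ** transpose H)) *v (H *v b - h))"

definition test_stat ::
  "nat \<Rightarrow> (nat \<Rightarrow> real^'p) \<Rightarrow> (nat \<Rightarrow> real) \<Rightarrow> real^'p^'q \<Rightarrow> real^'q \<Rightarrow> real" where
  "test_stat n x y H h =
     (let d = H *v ols n x y - h in
      (d \<bullet> (matrix_inv (H ** matrix_inv (gram n x) ** transpose H) *v d)) / resid_var n x y)"

definition stein_const :: "nat \<Rightarrow> real^'p^'q \<Rightarrow> real" where
  "stein_const n H =
     (let m = real n - real CARD('p) in m * (real CARD('q) - 2) / (m + 2))"

definition stein_lasso ::
  "nat \<Rightarrow> (nat \<Rightarrow> real^'p) \<Rightarrow> (nat \<Rightarrow> real) \<Rightarrow> real \<Rightarrow> real^'p^'q \<Rightarrow> real^'q \<Rightarrow> real^'p" where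
  "stein_lasso n x y l H h =
     lasso n x y l
       - (stein_const n H / test_stat n x y H h) *\<^sub>R (lasso n x y l - restricted_lasso n x y l H h)"

definition pos_stein_lasso ::
  "nat \<Rightarrow> (nat \<Rightarrow> real^'p) \<Rightarrow> (nat \<Rightarrow> real) \<Rightarrow> real \<Rightarrow> real^'p^'q \<Rightarrow> real^'q \<Rightarrow> real^'p" where
  "pos_stein_lasso n x y l H h =
     restricted_lasso n x y l H h
       + ((1 - stein_const n H / test_stat n x y H h)
            * of_bool (test_stat n x y H h > stein_const n H))
         *\<^sub>R (lasso n x y l - restricted_lasso n x y l H h)"

end

theory Submission
  imports Defs
begin

text \<open>
  Write \<open>Z\<^sub>n = \<surd>n (ols - \<beta>\<^sub>n)\<close>. Its law is exactly normal with covariance \<open>\<sigma>\<^sup>2 (C\<^sub>n / n)\<inverse>\<close>, and these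
  matrices converge, so \<open>Z\<^sub>n\<close> converges in distribution to \<open>W\<close> (\<open>conv_in_dist_normal\<close>). All the other
  statistics are functions of \<open>Z\<^sub>n\<close> and of a tuple \<open>E\<^sub>n\<close> of nuisance quantities that converges to a
  constant \<open>e\<close>:

  \<^item> The lasso is \<open>\<surd>n\<close>-equivalent to least squares, even deterministically. Up to a constant the
    objective is the quadratic form of \<open>C\<^sub>n\<close> centred at the OLS estimator plus the penalty; comparing
    its values at the minimizer and at the OLS estimator bounds \<open>\<surd>n |lasso - ols|\<close> by a multiple of
    \<open>\<lambda>\<^sub>n / \<surd>n\<close>, which tends to 0 (\<open>lasso_near_ols\<close>).
  \<^item> The residual variance converges to \<open>\<sigma>\<^sup>2\<close> in the mean, by the first two moments of the chi-square
    law (\<open>chi_square_L1_concentration\<close>).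
  \<^item> The matrices built from \<open>C\<^sub>n / n\<close> and \<open>H\<close> converge because inversion is continuous, and
    \<open>k\<^sub>n\<close> converges to \<open>k\<close>.

  In the local coordinates of \<open>estimators_in_local_coordinates\<close> every statistic has the form
  \<open>F (Z\<^sub>n, E\<^sub>n)\<close> with a fixed function \<open>F\<close> that is continuous at \<open>(w, e)\<close> for almost every \<open>w\<close>, hence it
  converges to the image of \<open>W\<close> under \<open>w \<mapsto> F (w, e)\<close> (\<open>conv_in_dist_map\<close>). In the normal claims this
  image is affine in \<open>w\<close>; with \<open>Q = G H\<close>, the covariances simplify because \<open>Q\<close> is a projection,
  orthogonal for the inner product given by \<open>C\<close> (\<open>restriction_projection\<close>). The two Stein-type estimators divide by
  the test statistic, so \<open>F\<close> need not be continuous where \<open>H w + \<xi> = 0\<close>; this is a null event because \<open>H W\<close> is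
  a nondegenerate normal vector. The indicator of the positive rule causes no further discontinuity, since
  \<open>(1 - k / L) I(L > k) = max 0 (1 - k / L)\<close> for \<open>L > 0\<close>.
\<close>

section \<open>Matrices\<close>

lemma tendsto_matrix_entry: "(f \<longlongrightarrow> (l::real^'n^'m)) F \<Longrightarrow> ((\<lambda>x. f x $ i $ j) \<longlongrightarrow> l $ i $ j) F"
  by (intro tendsto_vec_nth)

lemma tendsto_matrix_vector_mult:
  fixes A :: "'a \<Rightarrow> real^'n^'m"
  assumes "(A \<longlongrightarrow> A0) F" "(x \<longlongrightarrow> x0) F"
  shows "((\<lambda>t. A t *v x t) \<longlongrightarrow> A0 *v x0) F"
  unfolding matrix_vector_mult_def
  by (intro tendsto_vec_lambda tendsto_sum tendsto_mult tendsto_vec_nth assms)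

lemma tendsto_matrix_mult:
  fixes A :: "'a \<Rightarrow> real^'n^'m" and B :: "'a \<Rightarrow> real^'k^'n"
  assumes "(A \<longlongrightarrow> A0) F" "(B \<longlongrightarrow> B0) F"
  shows "((\<lambda>t. A t ** B t) \<longlongrightarrow> A0 ** B0) F"
  unfolding matrix_matrix_mult_def
  by (intro tendsto_vec_lambda tendsto_sum tendsto_mult tendsto_vec_nth assms)

lemma matrix_diff_mult:
  fixes A :: "real^'n^'m"
  shows "(A - A') ** B = A ** B - A' ** B" "B' ** (A - A') = B' ** A - B' ** A'"
  by (simp_all add: matrix_matrix_mult_def vec_eq_iff left_diff_distrib right_diff_distrib sum_subtractf)

lemma tendsto_det:
  fixes A :: "'a \<Rightarrow> real^'n^'n"
  assumes "\<And>i j. ((\<lambda>t. A t $ i $ j) \<longlongrightarrow> A0 $ i $ j) F"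
  shows "((\<lambda>t. det (A t)) \<longlongrightarrow> det A0) F"
  unfolding det_def by (intro tendsto_intros assms)

lemma invertible_matrix_inv:
  fixes A :: "real^'n^'n"
  assumes "invertible A"
  shows "A ** matrix_inv A = mat 1" "matrix_inv A ** A = mat 1"
proof -
  have "A ** matrix_inv A = mat 1 \<and> matrix_inv A ** A = mat 1"
    using assms unfolding invertible_def matrix_inv_def by (rule someI_ex)
  then show "A ** matrix_inv A = mat 1" "matrix_inv A ** A = mat 1" by auto
qed

lemma matrix_inv_unique:
  fixes A :: "real^'n^'n"
  assumes "A ** B = mat 1"
  shows "matrix_inv A = B"
proof -
  have "B ** A = mat 1" using assms matrix_left_right_inverse by blast
  then have "invertible A" using assms invertible_def by blast
  have "matrix_inv A = matrix_inv A ** (A ** B)" using assms by simp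
  also have "\<dots> = B" using invertible_matrix_inv[OF \<open>invertible A\<close>] by (simp add: matrix_mul_assoc)
  finally show ?thesis .
qed

lemma matrix_inv_scaleR:
  fixes A :: "real^'n^'n"
  assumes "invertible A" "c \<noteq> 0"
  shows "matrix_inv (c *\<^sub>R A) = (1 / c) *\<^sub>R matrix_inv A"
  by (rule matrix_inv_unique)
     (simp add: assms invertible_matrix_inv scalar_matrix_assoc[symmetric] matrix_scalar_ac)

text \<open>
  Cramer's rule writes each entry of the inverse as a quotient of polynomials in the entries of the
  matrix; the continuity of inversion follows.
\<close>

lemma matrix_inv_eq_cramer:
  fixes A :: "real^'n^'n"
  assumes "det A \<noteq> 0"
  shows "matrix_inv A $ k $ l = det (\<chi> i j. if j = k then axis l 1 $ i else A $ i $ j) / det A"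
proof -
  have inv: "invertible A" using assms invertible_det_nz by blast
  have "A *v (matrix_inv A *v axis l 1) = axis l 1"
    using invertible_matrix_inv[OF inv] by (simp add: matrix_vector_mul_assoc)
  then have "matrix_inv A *v axis l 1
      = (\<chi> k. det (\<chi> i j. if j = k then axis l 1 $ i else A $ i $ j) / det A)"
    by (subst (asm) cramer[OF assms])
  moreover have "(matrix_inv A *v axis l 1) $ k = matrix_inv A $ k $ l"
    by (simp add: matrix_vector_mult_basis column_def)
  ultimately show ?thesis by simp
qed

lemma tendsto_matrix_inv:
  fixes A :: "'a \<Rightarrow> real^'n^'n"
  assumes A: "(A \<longlongrightarrow> A0) F" and inv: "invertible A0"
  shows "((\<lambda>t. matrix_inv (A t)) \<longlongrightarrow> matrix_inv A0) F"
proof (intro vec_tendstoI)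
  fix k l
  have d0: "det A0 \<noteq> 0" using inv invertible_det_nz by blast
  have comp: "((\<lambda>t. A t $ i $ j) \<longlongrightarrow> A0 $ i $ j) F" for i j
    using A by (rule tendsto_matrix_entry)
  have dt: "((\<lambda>t. det (A t)) \<longlongrightarrow> det A0) F" by (rule tendsto_det) (rule comp)
  have ev: "eventually (\<lambda>t. det (A t) \<noteq> 0) F"
    using tendsto_imp_eventually_ne[OF dt d0] .
  have "((\<lambda>t. det (\<chi> i j. if j = k then axis l 1 $ i else A t $ i $ j) / det (A t)) \<longlongrightarrow>
      det (\<chi> i j. if j = k then axis l 1 $ i else A0 $ i $ j) / det A0) F"
  proof (intro tendsto_divide dt d0 tendsto_det)
    fix i j
    show "((\<lambda>t. (\<chi> i j. if j = k then axis l 1 $ i else A t $ i $ j) $ i $ j) \<longlongrightarrow>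
      (\<chi> i j. if j = k then axis l 1 $ i else A0 $ i $ j) $ i $ j) F"
      using comp[of i j] by (cases "j = k") simp_all
  qed
  then have "((\<lambda>t. det (\<chi> i j. if j = k then axis l 1 $ i else A t $ i $ j) / det (A t)) \<longlongrightarrow>
      matrix_inv A0 $ k $ l) F"
    by (simp add: matrix_inv_eq_cramer[OF d0])
  then show "((\<lambda>t. matrix_inv (A t) $ k $ l) \<longlongrightarrow> matrix_inv A0 $ k $ l) F"
    by (rule Lim_transform_eventually) (use ev in eventually_elim, simp add: matrix_inv_eq_cramer)
qed

lemma inner_matrix_transpose:
  fixes A :: "real^'n^'m"
  shows "x \<bullet> (A *v y) = (transpose A *v x) \<bullet> y"
  by (simp add: dot_lmul_matrix)

lemma pos_def_sym: "pos_def S \<Longrightarrow> u \<bullet> (S *v v) = (S *v u) \<bullet> v"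
  using inner_matrix_transpose[of u S v] by (simp add: pos_def_def)

lemma invertible_if_ker_trivial:
  fixes A :: "real^'n^'n"
  assumes "\<And>x. A *v x = 0 \<Longrightarrow> x = 0"
  shows "invertible A"
proof -
  obtain B where "B ** A = mat 1"
    using assms matrix_left_invertible_ker[of A] by auto
  then show ?thesis using invertible_left_inverse by blast
qed

lemma pos_def_invertible:
  assumes "pos_def S"
  shows "invertible S"
proof (rule invertible_if_ker_trivial)
  fix x assume "S *v x = 0"
  then have "x \<bullet> (S *v x) = 0" by simp
  then show "x = 0" using assms unfolding pos_def_def by force
qed

lemma matrix_inv_symmetric:
  fixes S :: "real^'n^'n"
  assumes "invertible S" "transpose S = S"
  shows "transpose (matrix_inv S) = matrix_inv S"
proof -
  have "transpose (matrix_inv S ** S) = mat 1"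
    using invertible_matrix_inv[OF assms(1)] by (simp add: transpose_mat)
  then have "S ** transpose (matrix_inv S) = mat 1"
    by (simp add: matrix_transpose_mul assms)
  then show ?thesis using matrix_inv_unique by metis
qed

lemma pos_def_matrix_inv:
  assumes "pos_def S"
  shows "pos_def (matrix_inv S)"
  unfolding pos_def_def
proof (intro conjI allI impI)
  have inv: "invertible S" using assms by (rule pos_def_invertible)
  show "transpose (matrix_inv S) = matrix_inv S"
    using assms inv matrix_inv_symmetric pos_def_def by blast
  fix v :: "real^'a" assume v: "v \<noteq> 0"
  define w where "w = matrix_inv S *v v"
  have vw: "v = S *v w"
    unfolding w_def by (simp add: matrix_vector_mul_assoc invertible_matrix_inv[OF inv])
  then have "w \<noteq> 0" using v by auto
  then have "0 < w \<bullet> (S *v w)" using assms pos_def_def by blast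
  then show "0 < v \<bullet> (matrix_inv S *v v)"
    unfolding w_def[symmetric] vw[symmetric] by (simp only: inner_commute)
qed

lemma pos_def_scaleR: "pos_def S \<Longrightarrow> c > 0 \<Longrightarrow> pos_def (c *\<^sub>R S)"
  by (auto simp: pos_def_def transpose_scalar scaleR_matrix_vector_assoc[symmetric])

text \<open>
  Independent rows make the transpose of \<open>H\<close> injective, so the form of \<open>H S H\<^sup>T\<close> takes values of the
  form of \<open>S\<close> at nonzero vectors.
\<close>

lemma pos_def_congruence:
  fixes S :: "real^'p^'p" and H :: "real^'p^'q"
  assumes S: "pos_def S" and H: "rank H = CARD('q)"
  shows "pos_def (H ** S ** transpose H)"
  unfolding pos_def_def
proof (intro conjI allI impI)
  show "transpose (H ** S ** transpose H) = H ** S ** transpose H"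
    using S by (simp add: matrix_transpose_mul pos_def_def matrix_mul_assoc)
  fix v :: "real^'q" assume v: "v \<noteq> 0"
  have "rank (transpose H) = CARD('q)" using H by (simp add: rank_transpose)
  then have "inj ((*v) (transpose H))" using full_rank_injective by blast
  then have "transpose H *v v \<noteq> 0"
    using v by (metis injD matrix_vector_mult_0_right)
  then have "0 < (transpose H *v v) \<bullet> (S *v (transpose H *v v))"
    using S pos_def_def by blast
  also have "\<dots> = v \<bullet> ((H ** S ** transpose H) *v v)"
    by (simp only: matrix_vector_mul_assoc[symmetric] inner_matrix_transpose[symmetric])
  finally show "0 < v \<bullet> ((H ** S ** transpose H) *v v)" .
qed

text \<open>
  By compactness the form attains a positive minimum on the unit sphere; homogeneity does the rest.
\<close>

lemma pos_def_lower_bound: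
  fixes S :: "real^'n^'n"
  assumes "pos_def S"
  obtains c where "c > 0" "\<And>v. c * (norm v)\<^sup>2 \<le> v \<bullet> (S *v v)"
proof -
  have c: "continuous_on (sphere 0 1) (\<lambda>v. v \<bullet> (S *v v))"
    by (intro continuous_intros)
  have ne: "sphere (0::real^'n) 1 \<noteq> {}" by simp
  obtain u where u: "u \<in> sphere 0 1" "\<And>v. v \<in> sphere 0 1 \<Longrightarrow> u \<bullet> (S *v u) \<le> v \<bullet> (S *v v)"
    using continuous_attains_inf[OF compact_sphere ne c] by blast
  show thesis
  proof
    have "u \<noteq> 0" using u(1) by auto
    then show "0 < u \<bullet> (S *v u)" using assms pos_def_def by blast
    fix v :: "real^'n"
    show "u \<bullet> (S *v u) * (norm v)\<^sup>2 \<le> v \<bullet> (S *v v)"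
    proof (cases "v = 0")
      case False
      have "u \<bullet> (S *v u) \<le> (v /\<^sub>R norm v) \<bullet> (S *v (v /\<^sub>R norm v))"
        using u(2)[of "v /\<^sub>R norm v"] False by simp
      also have "\<dots> = (v \<bullet> (S *v v)) / (norm v)\<^sup>2"
        by (simp add: matrix_vector_mult_scaleR power2_eq_square divide_inverse)
      finally show ?thesis using False by (simp add: field_simps)
    qed simp
  qed
qed

lemma quadratic_form_le_norm:
  fixes A :: "real^'n^'n"
  shows "\<bar>v \<bullet> (A *v v)\<bar> \<le> norm A * (norm v)\<^sup>2"
proof -
  have "\<bar>v \<bullet> (A *v v)\<bar> \<le> norm v * norm (A *v v)" by (rule Cauchy_Schwarz_ineq2)
  also have "norm (A *v v) \<le> norm A * norm v"
  proof -
    have "norm (A *v v) \<le> L2_set (\<lambda>i. norm (A $ i) * norm v) UNIV"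
      unfolding norm_vec_def[of "A *v v"]
      by (rule L2_set_mono) (simp_all add: matrix_vector_mul_component Cauchy_Schwarz_ineq2)
    also have "\<dots> = norm A * norm v"
      by (simp add: norm_vec_def[of A] L2_set_left_distrib)
    finally show ?thesis .
  qed
  then have "norm v * norm (A *v v) \<le> norm v * (norm A * norm v)"
    by (intro mult_left_mono) auto
  finally show ?thesis by (simp add: power2_eq_square algebra_simps)
qed

text \<open>
  Once \<open>S n\<close> is within \<open>c / 2\<close> of its limit, where \<open>c\<close> is the bound for the limit, at least half of
  that bound survives. The constant is the same for all large \<open>n\<close>.
\<close>

lemma eventually_quadratic_lower_bound:
  fixes S :: "nat \<Rightarrow> real^'n^'n"
  assumes lim: "S \<longlonglongrightarrow> S0" and "pos_def S0"
  obtains c where "c > 0" "\<forall>\<^sub>F n in sequentially. \<forall>v. c * (norm v)\<^sup>2 \<le> v \<bullet> (S n *v v)"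
proof -
  obtain c where c: "c > 0" "\<And>v. c * (norm v)\<^sup>2 \<le> v \<bullet> (S0 *v v)"
    using pos_def_lower_bound assms(2) by blast
  have "\<forall>\<^sub>F n in sequentially. dist (S n) S0 < c / 2"
    by (rule tendstoD[OF lim]) (use c(1) in simp)
  then have "\<forall>\<^sub>F n in sequentially. \<forall>v. c / 2 * (norm v)\<^sup>2 \<le> v \<bullet> (S n *v v)"
  proof eventually_elim
    case (elim n)
    show ?case
    proof
      fix v
      have "\<bar>v \<bullet> ((S n - S0) *v v)\<bar> \<le> c / 2 * (norm v)\<^sup>2"
        using quadratic_form_le_norm[of v "S n - S0"] elim
        by (smt (verit) dist_norm mult_right_mono zero_le_power2)
      then have "v \<bullet> (S n *v v) \<ge> v \<bullet> (S0 *v v) - c / 2 * (norm v)\<^sup>2"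
        unfolding matrix_vector_mult_diff_rdistrib inner_diff_right by linarith
      then show "c / 2 * (norm v)\<^sup>2 \<le> v \<bullet> (S n *v v)"
        using c(2)[of v] by (simp add: field_simps)
    qed
  qed
  with c(1) show thesis by (intro that[of "c/2"]) auto
qed

text \<open>
  A basis that is orthonormal for the inner product given by \<open>T = S\<inverse>\<close>, taken as the rows of a matrix
  \<open>R\<close>, satisfies \<open>R T R\<^sup>T = 1\<close> and hence \<open>R\<^sup>T R = S\<close>. As long as fewer vectors than the dimension have
  been chosen, some nonzero vector is orthogonal to all their images under \<open>T\<close>, so the basis can be
  extended.
\<close>

lemma pos_def_factorization:
  fixes S :: "real^'n^'n"
  assumes S: "pos_def S"
  obtains B :: "real^'n^'n" where "S = B ** transpose B"
proof -
  define T where "T = matrix_inv S"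
  have T: "pos_def T" unfolding T_def by (rule pos_def_matrix_inv[OF S])
  have "k \<le> CARD('n) \<Longrightarrow> \<exists>b :: nat \<Rightarrow> real^'n. \<forall>i<k. \<forall>j<k. b i \<bullet> (T *v b j) = (if i = j then 1 else 0)" for k
  proof (induction k)
    case (Suc k)
    then obtain b :: "nat \<Rightarrow> real^'n"
      where b: "\<And>i j. i < k \<Longrightarrow> j < k \<Longrightarrow> b i \<bullet> (T *v b j) = (if i = j then 1 else 0)"
      by auto
    have "dim ((\<lambda>i. T *v b i) ` {..<k}) \<le> card ((\<lambda>i. T *v b i) ` {..<k})"
      by (rule dim_le_card') simp
    also have "\<dots> \<le> k" using card_image_le[of "{..<k}"] by fastforce
    also have "\<dots> < DIM(real^'n)" using Suc.prems by simp
    finally obtain v where v: "v \<noteq> 0" "\<And>y. y \<in> span ((\<lambda>i. T *v b i) ` {..<k}) \<Longrightarrow> orthogonal v y"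
      using orthogonal_to_subspace_exists by blast
    have vb: "v \<bullet> (T *v b i) = 0" if "i < k" for i
      using v(2)[of "T *v b i"] that by (auto simp: orthogonal_def span_base)
    define c where "c = v \<bullet> (T *v v)"
    have c: "c > 0" using T v(1) unfolding c_def pos_def_def by blast
    define b' where "b' = b(k := (1 / sqrt c) *\<^sub>R v)"
    have "\<forall>i<Suc k. \<forall>j<Suc k. b' i \<bullet> (T *v b' j) = (if i = j then 1 else 0)"
    proof (intro allI impI)
      fix i j assume ij: "i < Suc k" "j < Suc k"
      have bv: "b i \<bullet> (T *v v) = 0" if "i < k" for i
        using vb[OF that] pos_def_sym[OF T, of "b i" v] by (simp add: inner_commute)
      have kk: "b' k \<bullet> (T *v b' k) = 1"
        using c by (simp add: b'_def matrix_vector_mult_scaleR c_def[symmetric])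
      show "b' i \<bullet> (T *v b' j) = (if i = j then 1 else 0)"
      proof (cases "i = k"; cases "j = k")
        assume "i \<noteq> k" "j \<noteq> k"
        then show ?thesis using b[of i j] ij by (simp add: b'_def)
      next
        assume "i = k" "j \<noteq> k"
        then show ?thesis using vb[of j] ij by (simp add: b'_def)
      next
        assume "i \<noteq> k" "j = k"
        then show ?thesis using bv[of i] ij by (simp add: b'_def matrix_vector_mult_scaleR)
      next
        assume "i = k" "j = k" then show ?thesis using kk by simp
      qed
    qed
    then show ?case by blast
  qed simp
  from this[of "CARD('n)"] obtain b :: "nat \<Rightarrow> real^'n"
    where b: "\<And>i j. i < CARD('n) \<Longrightarrow> j < CARD('n) \<Longrightarrow> b i \<bullet> (T *v b j) = (if i = j then 1 else 0)"
    by auto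
  obtain f :: "'n \<Rightarrow> nat" where f: "bij_betw f UNIV {0..<CARD('n)}"
    using ex_bij_betw_finite_nat[of "UNIV::'n set"] by auto
  have flt: "f i < CARD('n)" for i using f by (auto simp: bij_betw_def)
  have finj: "f i = f j \<longleftrightarrow> i = j" for i j using f by (auto simp: bij_betw_def inj_def)
  define R :: "real^'n^'n" where "R = (\<chi> i. b (f i))"
  have "R ** (T ** transpose R) = mat 1"
  proof -
    have "(R ** (T ** transpose R)) $ i $ j = b (f i) \<bullet> (T *v b (f j))" for i j
      by (simp add: matrix_matrix_mult_def matrix_vector_mult_def R_def transpose_def inner_vec_def)
    then show ?thesis by (simp add: vec_eq_iff mat_def b[OF flt flt] finj)
  qed
  then have "T ** transpose R ** R = mat 1"
    using matrix_left_right_inverse by blast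
  then have "transpose R ** R = matrix_inv T"
    by (metis matrix_inv_unique matrix_mul_assoc)
  also have "\<dots> = S" unfolding T_def
    by (rule matrix_inv_unique) (rule invertible_matrix_inv[OF pos_def_invertible[OF S]])
  finally show thesis using that[of "transpose R"] by simp
qed

section \<open>Normal laws\<close>

lemma prob_space_std_normal: "prob_space std_normal_distribution"
  using real_dist_normal_dist by (simp add: real_distribution_def)

text \<open>
  This representation includes the degenerate case, and it reduces the dependence of a normal law on
  its variance to the pointwise dependence of \<open>sqrt v * x\<close> on \<open>v\<close>.
\<close>

lemma normal_measure_eq_distr:
  assumes "v \<ge> 0"
  shows "normal_measure \<mu> v = distr std_normal_distribution borel (\<lambda>x. \<mu> + sqrt v * x)"
proof (cases "v = 0")
  case True
  interpret prob_space std_normal_distribution by (rule prob_space_std_normal)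
  show ?thesis using True by (simp add: normal_measure_def)
next
  case False
  then have v: "v > 0" using assms by simp
  interpret prob_space std_normal_distribution by (rule prob_space_std_normal)
  have "distributed std_normal_distribution lborel (\<lambda>x. x) (normal_density 0 1)"
    unfolding distributed_def by (auto intro!: measure_eqI simp: emeasure_distr)
  then have "distributed std_normal_distribution lborel (\<lambda>x. \<mu> + sqrt v * x)
      (normal_density (\<mu> + sqrt v * 0) (\<bar>sqrt v\<bar> * 1))"
    by (rule normal_density_affine) (use v in auto)
  then have "distr std_normal_distribution lborel (\<lambda>x. \<mu> + sqrt v * x)
      = density lborel (\<lambda>x. ennreal (normal_density \<mu> (sqrt v) x))"
    using v by (simp add: distributed_def)
  moreover have "distr std_normal_distribution lborel (\<lambda>x. \<mu> + sqrt v * x)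
      = distr std_normal_distribution borel (\<lambda>x. \<mu> + sqrt v * x)"
    by (rule distr_cong) auto
  ultimately show ?thesis using False by (simp add: normal_measure_def)
qed

lemma distr_normal_measure_add:
  assumes "v \<ge> 0"
  shows "distr (normal_measure \<mu> v) borel (\<lambda>x. x + c) = normal_measure (\<mu> + c) v"
  using assms by (simp add: normal_measure_eq_distr distr_distr comp_def add_ac)

lemma normal_law_prob_space:
  assumes "normal_law \<mu> S N"
  shows "prob_space N"
proof -
  have "distr N borel (\<lambda>x. 0 \<bullet> x) = normal_measure (0 \<bullet> \<mu>) (0 \<bullet> (S *v 0))"
    using assms normal_law_def by blast
  then have "distr N borel (\<lambda>x. 0::real) = return borel 0"
    by (simp add: normal_measure_def)
  then have "prob_space (distr N borel (\<lambda>x. 0::real))"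
    by (simp add: prob_space_return)
  then show ?thesis by (rule prob_space_distrD[rotated]) simp
qed

lemma normal_lawD:
  assumes "normal_law \<mu> S N"
  shows "transpose S = S" "0 \<le> t \<bullet> (S *v t)" "sets N = sets borel" "space N = UNIV"
    "distr N borel (\<lambda>x. t \<bullet> x) = normal_measure (t \<bullet> \<mu>) (t \<bullet> (S *v t))"
  using assms sets_eq_imp_space_eq[of N borel] unfolding normal_law_def by auto

lemma borel_measurable_matrix_vector_mult [measurable (raw)]:
  fixes A :: "real^'n^'m"
  assumes "f \<in> borel_measurable M"
  shows "(\<lambda>x. A *v f x) \<in> borel_measurable M"
  by (rule borel_measurable_continuous_on[OF matrix_vector_mult_linear_continuous_on assms])

text \<open>
  If \<open>L\<close> is the adjoint of the linear part of \<open>F\<close>, then the functional \<open>t\<close> of \<open>F x\<close> is, up to a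
  constant, the functional \<open>L t\<close> of \<open>x\<close>. Stating the lemma through \<open>L\<close> serves matrix images and block
  vectors alike.
\<close>

lemma normal_law_affine:
  fixes F :: "real^'p \<Rightarrow> real^'d"
  assumes N: "normal_law \<mu> S N"
    and F: "F \<in> borel_measurable borel"
    and adj: "\<And>t x. t \<bullet> F x = L t \<bullet> x + t \<bullet> c"
    and mean: "\<And>t. t \<bullet> \<nu> = L t \<bullet> \<mu> + t \<bullet> c"
    and sym: "transpose T = T"
    and cov: "\<And>t. t \<bullet> (T *v t) = L t \<bullet> (S *v L t)"
  shows "normal_law \<nu> T (distr N borel F)"
  unfolding normal_law_def
proof (intro conjI allI)
  note D = normal_lawD[OF N]
  show "transpose T = T" by (rule sym)
  show "sets (distr N borel F) = sets borel" by simp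
  fix t
  show "0 \<le> t \<bullet> (T *v t)" using D(2) by (simp add: cov)
  have mF: "F \<in> measurable N borel" using F D(3) by (simp cong: measurable_cong_sets)
  have "distr (distr N borel F) borel (\<lambda>x. t \<bullet> x) = distr N borel (\<lambda>x. L t \<bullet> x + t \<bullet> c)"
    using mF by (simp add: distr_distr comp_def adj)
  also have "\<dots> = distr (distr N borel (\<lambda>x. L t \<bullet> x)) borel (\<lambda>x. x + t \<bullet> c)"
    using D(3) by (subst distr_distr) (auto simp: comp_def cong: measurable_cong_sets)
  also have "\<dots> = normal_measure (t \<bullet> \<nu>) (t \<bullet> (T *v t))"
    using D(2) by (simp add: D(5) distr_normal_measure_add mean cov)
  finally show "distr (distr N borel F) borel (\<lambda>x. t \<bullet> x) = normal_measure (t \<bullet> \<nu>) (t \<bullet> (T *v t))" .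
qed

lemma normal_law_matrix_image:
  fixes B :: "real^'p^'d"
  assumes N: "normal_law \<mu> S N"
  shows "normal_law (B *v \<mu> + c) (B ** S ** transpose B) (distr N borel (\<lambda>x. B *v x + c))"
proof (rule normal_law_affine[OF N, where L = "\<lambda>t. transpose B *v t" and c = c])
  show "(\<lambda>x. B *v x + c) \<in> borel_measurable borel" by measurable
  show "t \<bullet> (B *v x + c) = (transpose B *v t) \<bullet> x + t \<bullet> c" for t x
    by (simp only: inner_add_right inner_matrix_transpose)
  then show "t \<bullet> (B *v \<mu> + c) = (transpose B *v t) \<bullet> \<mu> + t \<bullet> c" for t .
  show "transpose (B ** S ** transpose B) = B ** S ** transpose B"
    by (simp add: matrix_transpose_mul normal_lawD(1)[OF N] matrix_mul_assoc)
  show "t \<bullet> ((B ** S ** transpose B) *v t) = (transpose B *v t) \<bullet> (S *v (transpose B *v t))" for t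
    by (simp only: matrix_vector_mul_assoc[symmetric] inner_matrix_transpose[symmetric])
qed

lemma sum_UNIV_Plus: "(\<Sum>i\<in>(UNIV::('a::finite + 'b::finite) set). f i) = (\<Sum>i\<in>UNIV. f (Inl i)) + (\<Sum>i\<in>UNIV. f (Inr i))"
  by (subst UNIV_Plus_UNIV[symmetric], subst sum.Plus) auto

lemma block_vec_nth [simp]: "block_vec u v $ Inl a = u $ a" "block_vec u v $ Inr b = v $ b"
  by (simp_all add: block_vec_def)

lemma inner_block_vec: "block_vec u v \<bullet> block_vec u' v' = u \<bullet> u' + v \<bullet> v'"
  by (simp add: inner_vec_def sum_UNIV_Plus)

lemma block_mat_mult_block_vec:
  "block_mat P Q R S *v block_vec u v = block_vec (P *v u + Q *v v) (R *v u + S *v v)"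
  by (auto simp: vec_eq_iff matrix_vector_mult_def sum_UNIV_Plus block_mat_def block_vec_def split: sum.split)

lemma block_vec_cases: obtains u v where "t = block_vec u v"
proof
  show "t = block_vec (\<chi> a. t $ Inl a) (\<chi> b. t $ Inr b)"
    by (simp add: vec_eq_iff block_vec_def split: sum.split)
qed

lemma transpose_block_mat:
  "transpose (block_mat P Q R S) = block_mat (transpose P) (transpose R) (transpose Q) (transpose S)"
  by (simp add: vec_eq_iff transpose_def block_mat_def split: sum.split)

lemma borel_measurable_vec:
  fixes f :: "'a \<Rightarrow> real^'n"
  assumes "\<And>i. (\<lambda>x. f x $ i) \<in> borel_measurable M"
  shows "f \<in> borel_measurable M"
proof (subst borel_measurable_euclidean_space, rule ballI)
  fix b :: "real^'n" assume "b \<in> Basis"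
  then obtain i where "b = axis i 1" by (auto simp: Basis_vec_def)
  then show "(\<lambda>x. f x \<bullet> b) \<in> borel_measurable M" using assms[of i] by (simp add: inner_axis)
qed

lemma borel_measurable_vec_nth [measurable (raw)]:
  fixes f :: "'a \<Rightarrow> real^'n"
  assumes "f \<in> borel_measurable M"
  shows "(\<lambda>x. f x $ i) \<in> borel_measurable M"
  by (rule borel_measurable_continuous_on[OF _ assms]) (intro continuous_intros)

lemma borel_measurable_block_vec [measurable (raw)]:
  assumes "f \<in> borel_measurable M" "g \<in> borel_measurable M"
  shows "(\<lambda>x. block_vec (f x) (g x)) \<in> borel_measurable M"
proof (rule borel_measurable_vec)
  show "(\<lambda>x. block_vec (f x) (g x) $ i) \<in> borel_measurable M" for i
    by (cases i) (auto intro: borel_measurable_vec_nth assms)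
qed

lemma normal_law_block_image:
  fixes P :: "real^'p^'a" and Q :: "real^'p^'b"
  assumes N: "normal_law \<mu> S N"
  shows "normal_law (block_vec (P *v \<mu> + c) (Q *v \<mu> + d))
           (block_mat (P ** S ** transpose P) (P ** S ** transpose Q)
                      (Q ** S ** transpose P) (Q ** S ** transpose Q))
           (distr N borel (\<lambda>x. block_vec (P *v x + c) (Q *v x + d)))"
proof (rule normal_law_affine[OF N, where c = "block_vec c d"
      and L = "\<lambda>t. transpose P *v (\<chi> a. t $ Inl a) + transpose Q *v (\<chi> b. t $ Inr b)"])
  show "(\<lambda>x. block_vec (P *v x + c) (Q *v x + d)) \<in> borel_measurable borel" by measurable
  show *: "t \<bullet> block_vec (P *v x + c) (Q *v x + d)
      = (transpose P *v (\<chi> a. t $ Inl a) + transpose Q *v (\<chi> b. t $ Inr b)) \<bullet> x + t \<bullet> block_vec c d" for t x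
  proof -
    obtain u v where t: "t = block_vec u v" by (rule block_vec_cases)
    show ?thesis
      by (simp only: t inner_block_vec block_vec_nth vec_nth_inverse inner_add_left inner_add_right
           inner_matrix_transpose[symmetric])
  qed
  show "t \<bullet> block_vec (P *v \<mu> + c) (Q *v \<mu> + d)
      = (transpose P *v (\<chi> a. t $ Inl a) + transpose Q *v (\<chi> b. t $ Inr b)) \<bullet> \<mu> + t \<bullet> block_vec c d" for t
    by (rule *)
  show "transpose (block_mat (P ** S ** transpose P) (P ** S ** transpose Q)
          (Q ** S ** transpose P) (Q ** S ** transpose Q))
      = block_mat (P ** S ** transpose P) (P ** S ** transpose Q)
          (Q ** S ** transpose P) (Q ** S ** transpose Q)"
    by (simp add: transpose_block_mat matrix_transpose_mul normal_lawD(1)[OF N] matrix_mul_assoc)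
  fix t :: "real^('a + 'b)"
  obtain u v where t: "t = block_vec u v" by (rule block_vec_cases)
  show "t \<bullet> (block_mat (P ** S ** transpose P) (P ** S ** transpose Q)
          (Q ** S ** transpose P) (Q ** S ** transpose Q) *v t)
      = (transpose P *v (\<chi> a. t $ Inl a) + transpose Q *v (\<chi> b. t $ Inr b)) \<bullet>
        (S *v (transpose P *v (\<chi> a. t $ Inl a) + transpose Q *v (\<chi> b. t $ Inr b)))"
    by (simp only: t block_mat_mult_block_vec inner_block_vec block_vec_nth vec_nth_inverse
          matrix_vector_mul_assoc[symmetric] inner_add_left inner_add_right matrix_vector_right_distrib
          inner_matrix_transpose[symmetric])
qed

text \<open>
  The law of a vector of independent standard normal coordinates: its functionals are sums of
  independent normal variables.
\<close>

lemma std_gaussian_exists: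
  obtains N :: "(real^'d) measure" where "normal_law 0 (mat 1) N"
proof -
  define P where "P = PiM (UNIV::'d set) (\<lambda>_. std_normal_distribution)"
  define V where "V = (\<lambda>x::'d \<Rightarrow> real. \<chi> i. x i)"
  interpret std: prob_space std_normal_distribution by (rule prob_space_std_normal)
  interpret P: prob_space P unfolding P_def by (rule prob_space_PiM) (rule prob_space_std_normal)
  have coord [measurable]: "(\<lambda>x. x i) \<in> borel_measurable P" for i
    unfolding P_def by measurable
  have V [measurable]: "V \<in> borel_measurable P"
    by (rule borel_measurable_vec) (simp add: V_def)
  have distr_coord: "distr P borel (\<lambda>x. x i) = std_normal_distribution" for i
  proof -
    have "distr P std_normal_distribution (\<lambda>x. x i) = std_normal_distribution"
      unfolding P_def by (rule distr_PiM_component) (auto intro: prob_space_std_normal)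
    moreover have "distr P borel (\<lambda>x. x i) = distr P std_normal_distribution (\<lambda>x. x i)"
      by (rule distr_cong) auto
    ultimately show ?thesis by simp
  qed
  have indep: "P.indep_vars (\<lambda>_. borel) (\<lambda>i x. x i) UNIV"
  proof (subst P.indep_vars_iff_distr_eq_PiM')
    show "distr P (\<Pi>\<^sub>M i\<in>UNIV. borel) (\<lambda>x. \<lambda>i\<in>UNIV. x i) = (\<Pi>\<^sub>M i\<in>UNIV. distr P borel (\<lambda>x. x i))"
    proof -
      have "distr P (\<Pi>\<^sub>M i\<in>UNIV. borel) (\<lambda>x. \<lambda>i\<in>UNIV. x i) = distr P P (\<lambda>x. x)"
      proof (rule distr_cong)
        show "sets (\<Pi>\<^sub>M i\<in>UNIV. borel) = sets P" unfolding P_def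
          by (rule sets_PiM_cong) auto
      qed auto
      also have "\<dots> = P" by simp
      also have "\<dots> = (\<Pi>\<^sub>M i\<in>UNIV. distr P borel (\<lambda>x. x i))"
        unfolding distr_coord by (rule P_def)
      finally show ?thesis .
    qed
  qed auto
  have "normal_law 0 (mat 1) (distr P borel V)"
    unfolding normal_law_def
  proof (intro conjI allI)
    fix t :: "real^'d"
    show "0 \<le> t \<bullet> (mat 1 *v t)" by simp
    have eq: "distr (distr P borel V) borel (\<lambda>x. t \<bullet> x) = distr P borel (\<lambda>x. \<Sum>i\<in>UNIV. t $ i * x i)"
      by (subst distr_distr[OF _ V]) (auto simp: comp_def inner_vec_def V_def)
    show "distr (distr P borel V) borel (\<lambda>x. t \<bullet> x) = normal_measure (t \<bullet> 0) (t \<bullet> (mat 1 *v t))"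
    proof (cases "t = 0")
      case True
      show ?thesis unfolding eq using True by (simp add: normal_measure_def)
    next
      case False
      (* A vanishing coefficient would contribute a point mass, which has no density. *)
      define I where "I = {i. t $ i \<noteq> 0}"
      have I: "finite I" "I \<noteq> {}" using False by (auto simp: I_def vec_eq_iff)
      have "P.indep_vars (\<lambda>_. borel) (\<lambda>i x. t $ i * x i) I"
      proof -
        have "P.indep_vars (\<lambda>_. borel) (\<lambda>i x. x i) I"
          by (rule P.indep_vars_subset[OF indep]) auto
        then show ?thesis
          by (rule P.indep_vars_compose2) auto
      qed
      moreover have "distributed P lborel (\<lambda>x. t $ i * x i) (normal_density 0 \<bar>t $ i\<bar>)" if "i \<in> I" for i
      proof -
        have "distr P lborel (\<lambda>x. x i) = std_normal_distribution"
          using distr_coord[of i] by (metis distr_cong sets_lborel)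
        then have "distributed P lborel (\<lambda>x. x i) (normal_density 0 1)"
          by (simp add: distributed_def)
        then have "distributed P lborel (\<lambda>x. 0 + t $ i * x i) (normal_density (0 + t $ i * 0) (\<bar>t $ i\<bar> * 1))"
          by (rule P.normal_density_affine) (use that I_def in auto)
        then show ?thesis by simp
      qed
      ultimately have "distributed P lborel (\<lambda>x. \<Sum>i\<in>I. t $ i * x i)
         (normal_density (\<Sum>i\<in>I. 0) (sqrt (\<Sum>i\<in>I. \<bar>t $ i\<bar>\<^sup>2)))"
        by (intro P.sum_indep_normal I) (auto simp: I_def)
      moreover have "(\<Sum>i\<in>I. \<bar>t $ i\<bar>\<^sup>2) = t \<bullet> t"
        unfolding inner_vec_def I_def by (simp add: power2_eq_square) (rule sum.mono_neutral_left, auto)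
      moreover have "(\<lambda>x. \<Sum>i\<in>I. t $ i * x i) = (\<lambda>x. \<Sum>i\<in>UNIV. t $ i * x i)"
        unfolding I_def by (intro ext sum.mono_neutral_left) auto
      ultimately have "distr P lborel (\<lambda>x. \<Sum>i\<in>UNIV. t $ i * x i) = density lborel (normal_density 0 (sqrt (t \<bullet> t)))"
        by (simp add: distributed_def)
      moreover have "distr P lborel (\<lambda>x. \<Sum>i\<in>UNIV. t $ i * x i) = distr P borel (\<lambda>x. \<Sum>i\<in>UNIV. t $ i * x i)"
        by (rule distr_cong) auto
      ultimately show ?thesis unfolding eq using False by (simp add: normal_measure_def)
    qed
  qed (auto simp: transpose_mat)
  then show thesis by (rule that)
qed

section \<open>Weak convergence of normal laws\<close>

text \<open>
  Trigonometric polynomials with arbitrary frequencies: their expectations are finite linear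
  combinations of real and imaginary parts of the characteristic function.
\<close>

inductive trig_poly :: "(real^'d \<Rightarrow> real) \<Rightarrow> bool" where
  cos: "trig_poly (\<lambda>x. cos (t \<bullet> x + a))"
| scale: "trig_poly g \<Longrightarrow> trig_poly (\<lambda>x. c * g x)"
| add: "trig_poly f \<Longrightarrow> trig_poly g \<Longrightarrow> trig_poly (\<lambda>x. f x + g x)"

lemma trig_poly_const: "trig_poly (\<lambda>x. c)"
  using trig_poly.scale[OF trig_poly.cos[of 0 0], of c] by simp

lemma trig_poly_sin: "trig_poly (\<lambda>x. sin (t \<bullet> x))"
  using trig_poly.cos[of t "- pi / 2"] by (simp add: cos_diff)

lemma trig_poly_mult_cos:
  assumes "trig_poly g"
  shows "trig_poly (\<lambda>x. cos (t \<bullet> x + a) * g x)"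
  using assms
proof induction
  case (cos s b)
  have "(\<lambda>x. cos (t \<bullet> x + a) * cos (s \<bullet> x + b))
      = (\<lambda>x. 1/2 * cos ((t - s) \<bullet> x + (a - b)) + 1/2 * cos ((t + s) \<bullet> x + (a + b)))"
    by (simp add: cos_times_cos inner_add_left inner_diff_left algebra_simps add_divide_distrib)
  then show ?case
    by (simp only:) (intro trig_poly.intros)
next
  case (scale g c)
  from trig_poly.scale[OF scale.IH, of c] show ?case by (simp add: mult.left_commute)
next
  case (add f g)
  from trig_poly.add[OF add.IH] show ?case by (simp add: distrib_left)
qed

lemma trig_poly_mult:
  assumes "trig_poly f" "trig_poly g"
  shows "trig_poly (\<lambda>x. f x * g x)"
  using assms(1)
proof induction
  case (cos t a) show ?case by (rule trig_poly_mult_cos[OF assms(2)])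
next
  case (scale f c)
  from trig_poly.scale[OF scale.IH, of c] show ?case by (simp add: mult.assoc)
next
  case (add f f')
  from trig_poly.add[OF add.IH] show ?case by (simp add: distrib_right)
qed

lemma trig_poly_sum:
  assumes "finite I" "\<And>i. i \<in> I \<Longrightarrow> trig_poly (f i)"
  shows "trig_poly (\<lambda>x. \<Sum>i\<in>I. f i x)"
  using assms by (induction I) (auto intro: trig_poly_const trig_poly.add)

lemma trig_poly_continuous_bounded:
  assumes "trig_poly g"
  shows "continuous_on UNIV g \<and> (\<exists>B. \<forall>x. \<bar>g x\<bar> \<le> B)"
  using assms
proof induction
  case (cos t a)
  show ?case by (auto intro!: continuous_intros exI[of _ 1])
next
  case (scale g c)
  then obtain B where "\<And>x. \<bar>g x\<bar> \<le> B" by auto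
  then have "\<bar>c * g x\<bar> \<le> \<bar>c\<bar> * B" for x by (simp add: abs_mult mult_left_mono)
  with scale show ?case by (auto intro!: continuous_intros)
next
  case (add f g)
  then obtain B B' where "\<And>x. \<bar>f x\<bar> \<le> B" "\<And>x. \<bar>g x\<bar> \<le> B'" by auto
  then have "\<bar>f x + g x\<bar> \<le> B + B'" for x by (meson abs_triangle_ineq add_mono order_trans)
  with add show ?case by (auto intro!: continuous_intros)
qed

lemma trig_poly_of_real_polynomial:
  fixes p :: "real^'d \<Rightarrow> real"
  assumes "real_polynomial_function p"
  shows "trig_poly (\<lambda>x. p (\<chi> j. sin (r * x $ j)))"
  using assms
proof induction
  case (linear f)
  interpret bounded_linear f by (rule linear)
  have "f (\<chi> j. sin (r * x $ j)) = (\<Sum>j\<in>UNIV. f (axis j 1) * sin ((r *\<^sub>R axis j 1) \<bullet> x))" for x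
  proof -
    have "(\<chi> j. sin (r * x $ j)) = (\<Sum>j\<in>UNIV. sin (r * x $ j) *\<^sub>R axis j 1)"
      using basis_expansion[of "\<chi> j. sin (r * x $ j)"] by (simp add: scalar_mult_eq_scaleR)
    then have "f (\<chi> j. sin (r * x $ j)) = f (\<Sum>j\<in>UNIV. sin (r * x $ j) *\<^sub>R axis j 1)" by simp
    also have "\<dots> = (\<Sum>j\<in>UNIV. f (axis j 1) * sin ((r *\<^sub>R axis j 1) \<bullet> x))"
      by (simp add: sum scale inner_axis' mult.commute)
    finally show ?thesis .
  qed
  moreover have "trig_poly (\<lambda>x. \<Sum>j\<in>UNIV. f (axis j 1) * sin ((r *\<^sub>R axis j 1) \<bullet> x))"
    by (intro trig_poly_sum trig_poly.scale trig_poly_sin finite)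
  ultimately show ?case by presburger
qed (auto intro: trig_poly_const trig_poly.add trig_poly_mult)

text \<open>
  The approximation holds on a box, but the bound on all of space, which is what tightness arguments
  need. The map \<open>x \<mapsto> (sin (r x\<^sub>j))\<^sub>j\<close> sends all of space into the unit cube and is inverted on the box by
  \<open>arcsin\<close>. So \<open>v \<mapsto> f ((arcsin v\<^sub>j / r)\<^sub>j)\<close> is a function on the cube that is bounded by \<open>B\<close>, and a
  polynomial close to it by Stone-Weierstrass, composed with the sines, has both properties.
\<close>

lemma trig_poly_approximation:
  fixes f :: "real^'d \<Rightarrow> real"
  assumes cont: "continuous_on UNIV f" and bound: "\<And>x. \<bar>f x\<bar> \<le> B"
    and "e > 0" "R > 0"
  obtains g where "trig_poly g" "\<And>x. \<bar>g x\<bar> \<le> B + e"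
    "\<And>x. (\<And>j. \<bar>x $ j\<bar> \<le> R) \<Longrightarrow> \<bar>f x - g x\<bar> \<le> e"
proof -
  define r where "r = pi / (2 * R)"
  have r: "r > 0" using \<open>R > 0\<close> by (simp add: r_def)
  then have r_ne: "r \<noteq> 0" by simp
  define Q where "Q = (cbox (\<chi> j. - 1) (\<chi> j. 1) :: (real^'d) set)"
  have Q: "v \<in> Q \<longleftrightarrow> (\<forall>j. -1 \<le> v $ j \<and> v $ j \<le> 1)" for v
    by (simp add: Q_def mem_box_cart)
  have "continuous_on Q (\<lambda>v. f (\<chi> j. arcsin (v $ j) / r))"
    by (rule continuous_on_compose2[OF cont]) (auto intro!: continuous_intros simp: Q r_ne)
  moreover have "compact Q" unfolding Q_def by (rule compact_cbox)
  ultimately obtain p where p: "real_polynomial_function p"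
      "\<And>v. v \<in> Q \<Longrightarrow> \<bar>f (\<chi> j. arcsin (v $ j) / r) - p v\<bar> < e"
    using Stone_Weierstrass_real_polynomial_function[of Q "\<lambda>v. f (\<chi> j. arcsin (v $ j) / r)" e] \<open>e > 0\<close>
    by blast
  show thesis
  proof
    show "trig_poly (\<lambda>x. p (\<chi> j. sin (r * x $ j)))"
      by (rule trig_poly_of_real_polynomial[OF p(1)])
    fix x :: "real^'d"
    have inQ: "(\<chi> j. sin (r * x $ j)) \<in> Q" by (simp add: Q)
    show "\<bar>p (\<chi> j. sin (r * x $ j))\<bar> \<le> B + e"
      using p(2)[OF inQ] bound[of "\<chi> j. arcsin ((\<chi> j. sin (r * x $ j)) $ j) / r"] by linarith
    assume x: "\<And>j. \<bar>x $ j\<bar> \<le> R"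
    have "arcsin (sin (r * x $ j)) / r = x $ j" for j
    proof -
      have "\<bar>r * x $ j\<bar> \<le> r * R" using x[of j] r by (simp add: abs_mult)
      also have "r * R = pi / 2" using \<open>R > 0\<close> by (simp add: r_def)
      finally have "arcsin (sin (r * x $ j)) = r * x $ j" by (intro arcsin_sin) auto
      then show ?thesis using r by simp
    qed
    then have "(\<chi> j. arcsin ((\<chi> j. sin (r * x $ j)) $ j) / r) = x" by (simp add: vec_eq_iff)
    then show "\<bar>f x - p (\<chi> j. sin (r * x $ j))\<bar> \<le> e" using p(2)[OF inQ] by simp
  qed
qed

lemma borel_measurable_inner_const:
  fixes f :: "'a \<Rightarrow> real^'d"
  shows "f \<in> borel_measurable M \<Longrightarrow> (\<lambda>x. t \<bullet> f x) \<in> borel_measurable M"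
  by simp

lemma integral_of_normal_projection:
  fixes g :: "real \<Rightarrow> real" and Z :: "'a \<Rightarrow> real^'d"
  assumes Z: "Z \<in> borel_measurable M"
    and law: "distr M borel (\<lambda>\<omega>. t \<bullet> Z \<omega>) = normal_measure 0 v" and "v \<ge> 0"
    and g: "g \<in> borel_measurable borel"
  shows "(\<integral>\<omega>. g (t \<bullet> Z \<omega>) \<partial>M) = (\<integral>x. g (sqrt v * x) \<partial>std_normal_distribution)"
    "integrable M (\<lambda>\<omega>. g (t \<bullet> Z \<omega>)) \<longleftrightarrow> integrable std_normal_distribution (\<lambda>x. g (sqrt v * x))"
proof -
  have m: "(\<lambda>\<omega>. t \<bullet> Z \<omega>) \<in> measurable M borel" by (rule borel_measurable_inner_const[OF Z])
  have l: "distr M borel (\<lambda>\<omega>. t \<bullet> Z \<omega>) = distr std_normal_distribution borel (\<lambda>x. sqrt v * x)"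
    using law \<open>v \<ge> 0\<close> by (simp add: normal_measure_eq_distr)
  show "(\<integral>\<omega>. g (t \<bullet> Z \<omega>) \<partial>M) = (\<integral>x. g (sqrt v * x) \<partial>std_normal_distribution)"
    using integral_distr[OF m g] l integral_distr[of "\<lambda>x. sqrt v * x" std_normal_distribution borel g] g
    by simp
  show "integrable M (\<lambda>\<omega>. g (t \<bullet> Z \<omega>)) \<longleftrightarrow> integrable std_normal_distribution (\<lambda>x. g (sqrt v * x))"
    using integrable_distr_eq[OF m g] l integrable_distr_eq[of "\<lambda>x. sqrt v * x" std_normal_distribution borel g] g
    by simp
qed

lemma second_moment_of_normal_projection:
  fixes Z :: "'a \<Rightarrow> real^'d"
  assumes Z: "Z \<in> borel_measurable M"
    and law: "distr M borel (\<lambda>\<omega>. t \<bullet> Z \<omega>) = normal_measure 0 v" and "v \<ge> 0"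
  shows "integrable M (\<lambda>\<omega>. (t \<bullet> Z \<omega>)\<^sup>2)" "(\<integral>\<omega>. (t \<bullet> Z \<omega>)\<^sup>2 \<partial>M) = v"
proof -
  have "(\<integral>x. x\<^sup>2 \<partial>std_normal_distribution) = 1" "integrable std_normal_distribution (\<lambda>x. x\<^sup>2)"
    using std_normal_distribution_even_moments[of 1] by simp_all
  then have *: "(\<integral>x. (sqrt v * x)\<^sup>2 \<partial>std_normal_distribution) = v"
    "integrable std_normal_distribution (\<lambda>x. (sqrt v * x)\<^sup>2)"
    using \<open>v \<ge> 0\<close> by (simp_all add: power_mult_distrib)
  show "integrable M (\<lambda>\<omega>. (t \<bullet> Z \<omega>)\<^sup>2)" "(\<integral>\<omega>. (t \<bullet> Z \<omega>)\<^sup>2 \<partial>M) = v"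
    using integral_of_normal_projection[OF assms, of "\<lambda>x. x\<^sup>2"] * by simp_all
qed

text \<open>
  Outside the box the difference is at most \<open>2 B + e\<close>, while \<open>|x|\<^sup>2 / R\<^sup>2\<close> is at least 1 there; this is
  Chebyshev's inequality in integrated form.
\<close>

lemma integral_diff_le_outside_box:
  fixes f g :: "real^'d \<Rightarrow> real" and B e R V :: real
  assumes "prob_space M" and Z: "Z \<in> borel_measurable M"
    and f: "continuous_on UNIV f" "\<And>x. \<bar>f x\<bar> \<le> B"
    and g: "continuous_on UNIV g" "\<And>x. \<bar>g x\<bar> \<le> B + e"
    and fg: "\<And>x. (\<And>j. \<bar>x $ j\<bar> \<le> R) \<Longrightarrow> \<bar>f x - g x\<bar> \<le> e"
    and "e > 0" "R > 0"
    and Z2: "\<And>j. integrable M (\<lambda>\<omega>. (Z \<omega> $ j)\<^sup>2)" "\<And>j. (\<integral>\<omega>. (Z \<omega> $ j)\<^sup>2 \<partial>M) \<le> V"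
  shows "\<bar>(\<integral>\<omega>. f (Z \<omega>) \<partial>M) - (\<integral>\<omega>. g (Z \<omega>) \<partial>M)\<bar> \<le> e + (2 * B + e) * (CARD('d) * V) / R\<^sup>2"
proof -
  interpret prob_space M by fact
  have B: "B \<ge> 0" using f(2)[of 0] by linarith
  have fZ: "integrable M (\<lambda>\<omega>. f (Z \<omega>))"
    by (rule integrable_const_bound[of _ B])
       (use f Z in \<open>auto intro: borel_measurable_continuous_on\<close>)
  have gZ: "integrable M (\<lambda>\<omega>. g (Z \<omega>))"
    by (rule integrable_const_bound[of _ "B + e"])
       (use g Z in \<open>auto intro: borel_measurable_continuous_on\<close>)
  have pt: "\<bar>f x - g x\<bar> \<le> e + (2 * B + e) / R\<^sup>2 * (\<Sum>j\<in>UNIV. (x $ j)\<^sup>2)" for x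
  proof (cases "\<forall>j. \<bar>x $ j\<bar> \<le> R")
    case True
    then have "\<bar>f x - g x\<bar> \<le> e" using fg by blast
    moreover have "0 \<le> (2 * B + e) / R\<^sup>2 * (\<Sum>j\<in>UNIV. (x $ j)\<^sup>2)"
      using B \<open>e > 0\<close> by (intro mult_nonneg_nonneg sum_nonneg) auto
    ultimately show ?thesis by linarith
  next
    case False
    then obtain j where j: "\<bar>x $ j\<bar> > R" by (auto simp: not_le)
    have "R\<^sup>2 \<le> \<bar>x $ j\<bar>\<^sup>2" using j \<open>R > 0\<close> by (intro power_mono) auto
    also have "\<dots> \<le> (\<Sum>j\<in>UNIV. (x $ j)\<^sup>2)"
      using member_le_sum[of j UNIV "\<lambda>j. (x $ j)\<^sup>2"] by simp
    finally have "(2 * B + e) / R\<^sup>2 * R\<^sup>2 \<le> (2 * B + e) / R\<^sup>2 * (\<Sum>j\<in>UNIV. (x $ j)\<^sup>2)"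
      using B \<open>e > 0\<close> by (intro mult_left_mono) auto
    then have "2 * B + e \<le> (2 * B + e) / R\<^sup>2 * (\<Sum>j\<in>UNIV. (x $ j)\<^sup>2)"
      using \<open>R > 0\<close> by simp
    moreover have "\<bar>f x - g x\<bar> \<le> 2 * B + e" using f(2)[of x] g(2)[of x] by linarith
    ultimately show ?thesis using \<open>e > 0\<close> by linarith
  qed
  have "\<bar>(\<integral>\<omega>. f (Z \<omega>) \<partial>M) - (\<integral>\<omega>. g (Z \<omega>) \<partial>M)\<bar> = \<bar>\<integral>\<omega>. f (Z \<omega>) - g (Z \<omega>) \<partial>M\<bar>"
    using fZ gZ by simp
  also have "\<dots> \<le> (\<integral>\<omega>. \<bar>f (Z \<omega>) - g (Z \<omega>)\<bar> \<partial>M)"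
    by (rule integral_abs_bound)
  also have "\<dots> \<le> (\<integral>\<omega>. e + (2 * B + e) / R\<^sup>2 * (\<Sum>j\<in>UNIV. (Z \<omega> $ j)\<^sup>2) \<partial>M)"
    using fZ gZ Z2(1) by (intro integral_mono pt) auto
  also have "\<dots> = e + (2 * B + e) / R\<^sup>2 * (\<Sum>j\<in>UNIV. \<integral>\<omega>. (Z \<omega> $ j)\<^sup>2 \<partial>M)"
    using Z2(1) by (simp add: prob_space)
  also have "\<dots> \<le> e + (2 * B + e) / R\<^sup>2 * (\<Sum>j\<in>(UNIV::'d set). V)"
    using B \<open>e > 0\<close> Z2(2) by (intro add_left_mono mult_left_mono sum_mono) auto
  finally show ?thesis by simp
qed

lemma trig_poly_integral_tendsto:
  fixes W :: "(real^'d) measure"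
  assumes M: "\<And>n. prob_space (M n)" and Z: "\<And>n. Z n \<in> borel_measurable (M n)"
    and W: "prob_space W" "sets W = sets borel"
    and lim: "\<And>t a. (\<lambda>n. \<integral>\<omega>. cos (t \<bullet> Z n \<omega> + a) \<partial>M n) \<longlonglongrightarrow> (\<integral>x. cos (t \<bullet> x + a) \<partial>W)"
    and g: "trig_poly g"
  shows "(\<lambda>n. \<integral>\<omega>. g (Z n \<omega>) \<partial>M n) \<longlonglongrightarrow> (\<integral>x. g x \<partial>W)"
proof -
  have int: "integrable (M n) (\<lambda>\<omega>. g (Z n \<omega>))" if tp: "trig_poly g" for n and g :: "real^'d \<Rightarrow> real"
  proof -
    interpret prob_space "M n" by (rule M)
    obtain B where "continuous_on UNIV g" "\<And>x. \<bar>g x\<bar> \<le> B"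
      using trig_poly_continuous_bounded[OF tp] by blast
    then show ?thesis
      using Z by (intro integrable_const_bound[of _ B]) (auto intro: borel_measurable_continuous_on)
  qed
  have intW: "integrable W g" if tp: "trig_poly g" for g :: "real^'d \<Rightarrow> real"
  proof -
    interpret prob_space W by (rule W)
    obtain B where B: "continuous_on UNIV g" "\<And>x. \<bar>g x\<bar> \<le> B"
      using trig_poly_continuous_bounded[OF tp] by blast
    have "g \<in> borel_measurable W"
      using borel_measurable_continuous_onI[OF B(1)] W(2) by (simp cong: measurable_cong_sets)
    then show ?thesis
      using B by (intro integrable_const_bound[of _ B]) auto
  qed
  from g show ?thesis
  proof induction
    case (cos t a) show ?case by (rule lim)
  next
    case (scale g c)
    then show ?case by (auto intro!: tendsto_intros)
  next
    case (add f g)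
    have "(\<lambda>n. (\<integral>\<omega>. f (Z n \<omega>) \<partial>M n) + (\<integral>\<omega>. g (Z n \<omega>) \<partial>M n)) \<longlonglongrightarrow> (\<integral>x. f x \<partial>W) + (\<integral>x. g x \<partial>W)"
      by (intro tendsto_add add.IH)
    then show ?case using add.hyps int intW by simp
  qed
qed

text \<open>
  The convergence of the covariance matrices gives the convergence of the expectations of all
  cosines, hence of trigonometric polynomials, and a uniform bound for the second moments, hence
  tightness. Bounded continuous functions are then handled by approximation on a large box.
\<close>

lemma conv_in_dist_normal:
  fixes W :: "(real^'d) measure"
  assumes M: "\<And>n. prob_space (M n)"
    and Z0: "\<forall>\<^sub>F n in sequentially. Z n \<in> borel_measurable (M n) \<and> normal_law 0 (S n) (distr (M n) borel (Z n))"
    and S: "S \<longlonglongrightarrow> S0" and W: "normal_law 0 S0 W"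
  shows "conv_in_dist M Z W"
  unfolding conv_in_dist_def
proof (intro conjI allI impI)
  show "\<forall>\<^sub>F n in sequentially. Z n \<in> borel_measurable (M n)"
    using Z0 by eventually_elim simp
  fix f :: "real^'d \<Rightarrow> real" assume f: "continuous_on UNIV f \<and> bounded (range f)"
  then obtain B where B: "\<And>x. \<bar>f x\<bar> \<le> B" by (auto simp: bounded_iff)
  have B0: "B \<ge> 0" using B[of 0] by linarith
  note DW = normal_lawD[OF W]
  interpret W: prob_space W by (rule normal_law_prob_space[OF W])
  obtain N where N: "\<And>n. n \<ge> N \<Longrightarrow> Z n \<in> borel_measurable (M n)"
      "\<And>n. n \<ge> N \<Longrightarrow> normal_law 0 (S n) (distr (M n) borel (Z n))"
    using Z0 by (auto simp: eventually_sequentially)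
  (* The shift by N makes measurability and normality hold for all indices. *)
  define M' where "M' n = M (n + N)" for n
  define Z' where "Z' n = Z (n + N)" for n
  define S' where "S' n = S (n + N)" for n
  have S': "S' \<longlonglongrightarrow> S0" unfolding S'_def using S by (rule LIMSEQ_ignore_initial_segment)
  have M': "prob_space (M' n)" for n using M by (simp add: M'_def)
  have Z': "Z' n \<in> borel_measurable (M' n)" for n using N by (simp add: M'_def Z'_def)
  have v: "0 \<le> t \<bullet> (S' n *v t)" for n t
    using normal_lawD(2)[OF N(2)[of "n + N"]] by (simp add: S'_def)
  have law: "distr (M' n) borel (\<lambda>\<omega>. t \<bullet> Z' n \<omega>) = normal_measure 0 (t \<bullet> (S' n *v t))" for n t
    using normal_lawD(5)[OF N(2)[of "n + N"], of t] N(1)[of "n + N"]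
    by (simp add: distr_distr comp_def M'_def Z'_def S'_def)
  have mW: "(\<lambda>x. x) \<in> borel_measurable W" using DW(3) by (simp cong: measurable_cong_sets)
  have lawW: "distr W borel (\<lambda>x. t \<bullet> x) = normal_measure 0 (t \<bullet> (S0 *v t))" for t
    using DW(5)[of t] by simp
  have vlim: "(\<lambda>n. t \<bullet> (S' n *v t)) \<longlonglongrightarrow> t \<bullet> (S0 *v t)" for t
    by (intro tendsto_inner tendsto_const tendsto_matrix_vector_mult S')
  interpret std: prob_space std_normal_distribution by (rule prob_space_std_normal)
  have coslim: "(\<lambda>n. \<integral>\<omega>. cos (t \<bullet> Z' n \<omega> + a) \<partial>M' n) \<longlonglongrightarrow> (\<integral>x. cos (t \<bullet> x + a) \<partial>W)" for t a
  proof -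
    have "(\<lambda>n. \<integral>x. cos (sqrt (t \<bullet> (S' n *v t)) * x + a) \<partial>std_normal_distribution)
        \<longlonglongrightarrow> (\<integral>x. cos (sqrt (t \<bullet> (S0 *v t)) * x + a) \<partial>std_normal_distribution)"
      by (rule integral_dominated_convergence[where w = "\<lambda>_. 1"])
         (auto intro!: tendsto_intros vlim)
    then show ?thesis
      using integral_of_normal_projection(1)[OF Z' law v, of "\<lambda>y. cos (y + a)"]
        integral_of_normal_projection(1)[OF mW lawW DW(2), of "\<lambda>y. cos (y + a)"]
      by simp
  qed
  define V where "V = 1 + (\<Sum>j\<in>UNIV. S0 $ j $ j)"
  have axis: "axis j 1 \<bullet> (T *v axis j 1) = T $ j $ j" for j and T :: "real^'d^'d"
    by (simp add: inner_axis' matrix_vector_mult_basis column_def)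
  have diag: "0 \<le> S0 $ j $ j" for j using DW(2)[of "axis j 1"] by (simp add: axis)
  have V1: "S0 $ j $ j < V" for j
    using member_le_sum[of j UNIV "\<lambda>j. S0 $ j $ j"] diag by (simp add: V_def)
  have evV: "\<forall>\<^sub>F n in sequentially. \<forall>j. S' n $ j $ j \<le> V"
  proof -
    have "\<forall>\<^sub>F n in sequentially. S' n $ j $ j \<le> V" for j
      using order_tendstoD(2)[OF tendsto_matrix_entry[OF S', of j j] V1[of j]]
      by (rule eventually_mono) simp
    then show ?thesis by (simp add: eventually_all_finite)
  qed
  have "(\<lambda>n. \<integral>\<omega>. f (Z' n \<omega>) \<partial>M' n) \<longlonglongrightarrow> (\<integral>z. f z \<partial>W)"
  proof (rule tendstoI)
    fix \<eta> :: real assume \<eta>: "\<eta> > 0"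
    define e where "e = min 1 (\<eta> / 6)"
    have e: "e > 0" "e \<le> 1" "5 * e < \<eta>" using \<eta> by (auto simp: e_def)
    (* R makes the error K / R^2 that is committed outside the box at most e. *)
    define K where "K = (2 * B + e) * (CARD('d) * V)"
    have "V \<ge> 0" using diag by (simp add: V_def sum_nonneg add_nonneg_nonneg)
    then have K: "K \<ge> 0" using B0 e by (simp add: K_def)
    define R where "R = sqrt (K / e + 1)"
    have Ke: "K / e + 1 > 0" using K e by (simp add: add_nonneg_pos)
    then have R: "R > 0" "R\<^sup>2 = K / e + 1" by (auto simp: R_def)
    have KR: "K / R\<^sup>2 \<le> e" unfolding R(2) using Ke e by (simp add: pos_divide_le_eq distrib_left)
    obtain g where g: "trig_poly g" "\<And>x. \<bar>g x\<bar> \<le> B + e"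
      "\<And>x. (\<And>j. \<bar>x $ j\<bar> \<le> R) \<Longrightarrow> \<bar>f x - g x\<bar> \<le> e"
      using trig_poly_approximation[of f B e R] f B e R by blast
    have gc: "continuous_on UNIV g" using trig_poly_continuous_bounded[OF g(1)] by blast
    note close = integral_diff_le_outside_box[OF _ _ conjunct1[OF f] B gc g(2) g(3) e(1) R(1), where V = V, folded K_def]
    have "\<bar>(\<integral>x. f x \<partial>W) - (\<integral>x. g x \<partial>W)\<bar> \<le> e + K / R\<^sup>2"
    proof (rule close[OF W.prob_space_axioms mW])
      fix j
      show "integrable W (\<lambda>x. (x $ j)\<^sup>2)" "(\<integral>x. (x $ j)\<^sup>2 \<partial>W) \<le> V"
        using second_moment_of_normal_projection[OF mW lawW[of "axis j 1"] DW(2)] V1[of j]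
        by (simp_all add: inner_axis' matrix_vector_mult_basis column_def)
    qed
    then have cW: "\<bar>(\<integral>x. f x \<partial>W) - (\<integral>x. g x \<partial>W)\<bar> \<le> 2 * e" using KR by linarith
    have cZ: "\<forall>\<^sub>F n in sequentially. \<bar>(\<integral>\<omega>. f (Z' n \<omega>) \<partial>M' n) - (\<integral>\<omega>. g (Z' n \<omega>) \<partial>M' n)\<bar> \<le> 2 * e"
      using evV
    proof eventually_elim
      case (elim n)
      have "\<bar>(\<integral>\<omega>. f (Z' n \<omega>) \<partial>M' n) - (\<integral>\<omega>. g (Z' n \<omega>) \<partial>M' n)\<bar> \<le> e + K / R\<^sup>2"
      proof (rule close[OF M' Z'])
        fix j
        show "integrable (M' n) (\<lambda>\<omega>. (Z' n \<omega> $ j)\<^sup>2)" "(\<integral>\<omega>. (Z' n \<omega> $ j)\<^sup>2 \<partial>M' n) \<le> V"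
          using second_moment_of_normal_projection[OF Z' law[of n "axis j 1"] v] elim
          by (simp_all add: inner_axis' matrix_vector_mult_basis column_def)
      qed
      then show ?case using KR by linarith
    qed
    have "(\<lambda>n. \<integral>\<omega>. g (Z' n \<omega>) \<partial>M' n) \<longlonglongrightarrow> (\<integral>x. g x \<partial>W)"
      by (rule trig_poly_integral_tendsto[OF M' Z' W.prob_space_axioms DW(3) coslim g(1)])
    then have "\<forall>\<^sub>F n in sequentially. dist (\<integral>\<omega>. g (Z' n \<omega>) \<partial>M' n) (\<integral>x. g x \<partial>W) < e"
      using e(1) by (rule tendstoD)
    with cZ show "\<forall>\<^sub>F n in sequentially. dist (\<integral>\<omega>. f (Z' n \<omega>) \<partial>M' n) (\<integral>x. f x \<partial>W) < \<eta>"
    proof eventually_elim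
      case (elim n)
      then show ?case using cW e(3) unfolding dist_real_def by linarith
    qed
  qed
  then show "(\<lambda>n. \<integral>\<omega>. f (Z n \<omega>) \<partial>M n) \<longlonglongrightarrow> (\<integral>z. f z \<partial>W)"
    unfolding M'_def Z'_def by (rule LIMSEQ_offset)
qed

section \<open>Continuous mapping with a vanishing perturbation\<close>

text \<open>
  The Pasch-Hausdorff envelope: the largest \<open>k\<close>-Lipschitz function below \<open>\<phi>\<close>.
\<close>

definition lipschitz_envelope :: "('a::metric_space \<Rightarrow> real) \<Rightarrow> real \<Rightarrow> 'a \<Rightarrow> real" where
  "lipschitz_envelope \<phi> k x = (INF y. \<phi> y + k * dist x y)"

context
  fixes \<phi> :: "'a::metric_space \<Rightarrow> real" and B k :: real
  assumes bound: "\<And>x. \<bar>\<phi> x\<bar> \<le> B" and k: "k \<ge> 0"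
begin

lemma lipschitz_envelope_bdd: "bdd_below (range (\<lambda>y. \<phi> y + k * dist x y))"
proof (rule bdd_belowI2)
  fix y show "- B \<le> \<phi> y + k * dist x y"
    using bound[of y] k mult_nonneg_nonneg[OF k zero_le_dist[of x y]] by linarith
qed

lemma lipschitz_envelope_lower: "- B \<le> lipschitz_envelope \<phi> k x"
  unfolding lipschitz_envelope_def
proof (rule cINF_greatest)
  fix y show "- B \<le> \<phi> y + k * dist x y"
    using bound[of y] k mult_nonneg_nonneg[OF k zero_le_dist[of x y]] by linarith
qed simp

lemma lipschitz_envelope_le: "lipschitz_envelope \<phi> k x \<le> \<phi> x"
  using cINF_lower[OF lipschitz_envelope_bdd, of x x] by (simp add: lipschitz_envelope_def)

lemma lipschitz_envelope_lipschitz: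
  "lipschitz_envelope \<phi> k x \<le> lipschitz_envelope \<phi> k y + k * dist x y"
proof -
  have "lipschitz_envelope \<phi> k x - k * dist x y \<le> lipschitz_envelope \<phi> k y"
    unfolding lipschitz_envelope_def[of \<phi> k y]
  proof (rule cINF_greatest)
    fix z
    have "lipschitz_envelope \<phi> k x \<le> \<phi> z + k * dist x z"
      unfolding lipschitz_envelope_def by (rule cINF_lower[OF lipschitz_envelope_bdd]) simp
    also have "k * dist x z \<le> k * (dist x y + dist y z)"
      using k by (intro mult_left_mono dist_triangle)
    finally show "lipschitz_envelope \<phi> k x - k * dist x y \<le> \<phi> z + k * dist y z"
      by (simp add: algebra_simps)
  qed simp
  then show ?thesis by linarith
qed

lemma lipschitz_envelope_continuous: "continuous_on UNIV (lipschitz_envelope \<phi> k)"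
proof (rule lipschitz_on_continuous_on[where L = k])
  show "k-lipschitz_on UNIV (lipschitz_envelope \<phi> k)"
  proof (rule lipschitz_onI)
    fix x y :: 'a
    show "dist (lipschitz_envelope \<phi> k x) (lipschitz_envelope \<phi> k y) \<le> k * dist x y"
      using lipschitz_envelope_lipschitz[of x y] lipschitz_envelope_lipschitz[of y x]
      by (simp add: dist_real_def dist_commute abs_le_iff)
  qed (rule k)
qed

end

text \<open>
  Away from \<open>x\<close> the term \<open>k * dist x y\<close> eventually exceeds the oscillation \<open>2 B\<close> of \<open>\<phi>\<close>, so for large
  \<open>k\<close> only the values of \<open>\<phi>\<close> near \<open>x\<close> matter.
\<close>

lemma lipschitz_envelope_tendsto:
  fixes \<phi> :: "'a::metric_space \<Rightarrow> real"
  assumes bound: "\<And>x. \<bar>\<phi> x\<bar> \<le> B" and cont: "isCont \<phi> x"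
  shows "(\<lambda>k::nat. lipschitz_envelope \<phi> (real k) x) \<longlonglongrightarrow> \<phi> x"
proof (rule tendstoI)
  fix \<eta> :: real assume \<eta>: "\<eta> > 0"
  have "\<eta> / 2 > 0" using \<eta> by simp
  then obtain d where d: "d > 0" "\<And>y. dist y x < d \<Longrightarrow> dist (\<phi> y) (\<phi> x) < \<eta> / 2"
    using cont unfolding continuous_at_eps_delta by blast
  obtain K :: nat where K: "2 * B / d \<le> K" using real_arch_simple by blast
  have "dist (lipschitz_envelope \<phi> (real k) x) (\<phi> x) < \<eta>" if "k \<ge> K" for k
  proof -
    have "\<phi> x - \<eta> / 2 \<le> lipschitz_envelope \<phi> (real k) x"
      unfolding lipschitz_envelope_def
    proof (rule cINF_greatest)
      fix y
      show "\<phi> x - \<eta> / 2 \<le> \<phi> y + real k * dist x y"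
      proof (cases "dist y x < d")
        case True
        then have "\<phi> x - \<eta> / 2 \<le> \<phi> y" using d(2)[OF True] unfolding dist_real_def by linarith
        moreover have "0 \<le> real k * dist x y" by simp
        ultimately show ?thesis by linarith
      next
        case False
        have "2 * B \<le> real K * d" using K d(1) by (simp add: pos_divide_le_eq)
        also have "\<dots> \<le> real k * dist x y"
          using that False d(1) by (intro mult_mono) (auto simp: dist_commute)
        finally show ?thesis using bound[of x] bound[of y] \<eta> by linarith
      qed
    qed simp
    moreover have "lipschitz_envelope \<phi> (real k) x \<le> \<phi> x"
      using bound by (rule lipschitz_envelope_le) simp
    ultimately show ?thesis using \<eta> by (simp add: dist_real_def)
  qed
  then show "\<forall>\<^sub>F k in sequentially. dist (lipschitz_envelope \<phi> (real k) x) (\<phi> x) < \<eta>"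
    by (auto simp: eventually_sequentially)
qed

text \<open>
  The function \<open>f \<circ> F\<close> need not be continuous, but its Lipschitz envelopes are, and they lie below it.
  Their Lipschitz property allows \<open>E n\<close> to be replaced by \<open>e\<close> at the cost of \<open>k\<close> times the integral of
  \<open>D n\<close>; weak convergence applies to the result; and as \<open>k\<close> grows the envelopes increase to \<open>f \<circ> F\<close> at
  the points of continuity, that is, almost everywhere in the limit.
\<close>

lemma liminf_integral_map:
  fixes Z :: "nat \<Rightarrow> 'w \<Rightarrow> 'a::euclidean_space" and F :: "'a \<times> 'e::metric_space \<Rightarrow> 'c::euclidean_space"
    and f :: "'c \<Rightarrow> real"
  assumes M: "\<And>n. prob_space (M n)" and W: "prob_space W" "sets W = sets borel"
    and Z: "conv_in_dist M Z W"
    and V: "\<forall>\<^sub>F n in sequentially. V n \<in> borel_measurable (M n)"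
    and rep: "\<forall>\<^sub>F n in sequentially. \<forall>\<omega>\<in>space (M n).
                V n \<omega> = F (Z n \<omega>, E n \<omega>) \<and> dist (E n \<omega>) e \<le> D n \<omega>"
    and D: "\<forall>\<^sub>F n in sequentially. integrable (M n) (D n)"
    and D0: "(\<lambda>n. \<integral>\<omega>. D n \<omega> \<partial>M n) \<longlonglongrightarrow> 0"
    and cont: "AE w in W. isCont F (w, e) \<and> g w = F (w, e)"
    and g: "g \<in> borel_measurable borel"
    and f: "continuous_on UNIV f" "\<And>x. \<bar>f x\<bar> \<le> B" and \<eta>: "\<eta> > 0"
  shows "\<forall>\<^sub>F n in sequentially. (\<integral>w. f (g w) \<partial>W) - \<eta> < (\<integral>\<omega>. f (V n \<omega>) \<partial>M n)"
proof -
  interpret W: prob_space W by (rule W)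
  define \<phi> where "\<phi> = (\<lambda>u. f (F u))"
  have b\<phi>: "\<bar>\<phi> u\<bar> \<le> B" for u using f(2) by (simp add: \<phi>_def)
  define env where "env k w = lipschitz_envelope \<phi> (real k) (w, e)" for k w
  have env_bound: "\<bar>env k w\<bar> \<le> B" for k w
  proof -
    have "- B \<le> env k w"
      unfolding env_def by (rule lipschitz_envelope_lower[OF b\<phi>]) simp
    moreover have "env k w \<le> \<phi> (w, e)"
      unfolding env_def by (rule lipschitz_envelope_le[OF b\<phi>]) simp
    ultimately show ?thesis using b\<phi>[of "(w, e)"] by linarith
  qed
  have env_cont: "continuous_on UNIV (env k)" for k
    unfolding env_def
    by (rule continuous_on_compose2[OF lipschitz_envelope_continuous[OF b\<phi> of_nat_0_le_iff]])
       (auto intro!: continuous_intros)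
  have env_meas: "env k \<in> borel_measurable borel" for k
    using env_cont by (rule borel_measurable_continuous_onI)
  have fg: "(\<lambda>w. f (g w)) \<in> borel_measurable borel"
    using f(1) g by (rule borel_measurable_continuous_on)
  have "(\<lambda>k. \<integral>w. env k w \<partial>W) \<longlonglongrightarrow> (\<integral>w. f (g w) \<partial>W)"
  proof (rule integral_dominated_convergence[where w = "\<lambda>_. B"])
    show "AE w in W. (\<lambda>k. env k w) \<longlonglongrightarrow> f (g w)"
      using cont
    proof eventually_elim
      case (elim w)
      have "isCont f (F (w, e))"
        using f(1) by (simp add: continuous_on_eq_continuous_at)
      then have "isCont \<phi> (w, e)"
        unfolding \<phi>_def by (rule isCont_o2[OF conjunct1[OF elim]])
      then have "(\<lambda>k. env k w) \<longlonglongrightarrow> \<phi> (w, e)"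
        unfolding env_def by (intro lipschitz_envelope_tendsto[OF b\<phi>])
      then show ?case using elim by (simp add: \<phi>_def)
    qed
  qed (use fg env_meas env_bound W(2) in \<open>auto cong: measurable_cong_sets\<close>)
  then have "\<forall>\<^sub>F k in sequentially. (\<integral>w. f (g w) \<partial>W) - \<eta> / 2 < (\<integral>w. env k w \<partial>W)"
    using \<eta> by (intro order_tendstoD) auto
  then obtain k where k: "(\<integral>w. f (g w) \<partial>W) - \<eta> / 2 < (\<integral>w. env k w \<partial>W)"
    by (auto simp: eventually_sequentially)
  have "bounded (range (env k))" using env_bound by (auto simp: bounded_iff)
  then have "(\<lambda>n. \<integral>\<omega>. env k (Z n \<omega>) \<partial>M n) \<longlonglongrightarrow> (\<integral>w. env k w \<partial>W)"
    using Z env_cont unfolding conv_in_dist_def by blast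
  then have "(\<lambda>n. (\<integral>\<omega>. env k (Z n \<omega>) \<partial>M n) - real k * (\<integral>\<omega>. D n \<omega> \<partial>M n))
      \<longlonglongrightarrow> (\<integral>w. env k w \<partial>W) - real k * 0"
    by (intro tendsto_intros D0)
  then have "\<forall>\<^sub>F n in sequentially. (\<integral>w. env k w \<partial>W) - \<eta> / 2
      < (\<integral>\<omega>. env k (Z n \<omega>) \<partial>M n) - real k * (\<integral>\<omega>. D n \<omega> \<partial>M n)"
    using \<eta> by (intro order_tendstoD) auto
  moreover have "\<forall>\<^sub>F n in sequentially. Z n \<in> borel_measurable (M n)"
    using Z by (simp add: conv_in_dist_def)
  ultimately show ?thesis using V rep D
  proof eventually_elim
    case (elim n)
    interpret prob_space "M n" by (rule M)
    have iE: "integrable (M n) (\<lambda>\<omega>. env k (Z n \<omega>))"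
      using env_bound elim(2) by (intro integrable_const_bound[of _ B])
        (auto intro: borel_measurable_continuous_on[OF env_cont])
    have iV: "integrable (M n) (\<lambda>\<omega>. f (V n \<omega>))"
      using f elim(3) by (intro integrable_const_bound[of _ B])
        (auto intro: borel_measurable_continuous_on[OF f(1)])
    have "(\<integral>\<omega>. env k (Z n \<omega>) \<partial>M n) - real k * (\<integral>\<omega>. D n \<omega> \<partial>M n)
        = (\<integral>\<omega>. env k (Z n \<omega>) - real k * D n \<omega> \<partial>M n)"
      using iE elim(5) by simp
    also have "\<dots> \<le> (\<integral>\<omega>. f (V n \<omega>) \<partial>M n)"
    proof (rule integral_mono)
      fix \<omega> assume \<omega>: "\<omega> \<in> space (M n)"
      have "env k (Z n \<omega>) \<le> lipschitz_envelope \<phi> (real k) (Z n \<omega>, E n \<omega>)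
          + real k * dist (Z n \<omega>, e) (Z n \<omega>, E n \<omega>)"
        unfolding env_def by (rule lipschitz_envelope_lipschitz[OF b\<phi>]) auto
      also have "lipschitz_envelope \<phi> (real k) (Z n \<omega>, E n \<omega>) \<le> \<phi> (Z n \<omega>, E n \<omega>)"
        by (rule lipschitz_envelope_le[OF b\<phi>]) auto
      also have "\<phi> (Z n \<omega>, E n \<omega>) = f (V n \<omega>)"
        using elim(4) \<omega> by (simp add: \<phi>_def)
      also have "dist (Z n \<omega>, e) (Z n \<omega>, E n \<omega>) \<le> D n \<omega>"
        using elim(4) \<omega> by (simp add: dist_Pair_Pair dist_commute)
      finally show "env k (Z n \<omega>) - real k * D n \<omega> \<le> f (V n \<omega>)"
        by (simp add: mult_left_mono)
    qed (use iE iV elim(5) in auto)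
    finally show ?case using elim(1) k by linarith
  qed
qed

text \<open>
  The continuous mapping theorem and Slutsky's lemma in one statement. It follows from the lower
  bound applied to \<open>f\<close> and to \<open>- f\<close>.
\<close>

lemma conv_in_dist_map:
  fixes Z :: "nat \<Rightarrow> 'w \<Rightarrow> 'a::euclidean_space" and F :: "'a \<times> 'e::metric_space \<Rightarrow> 'c::euclidean_space"
  assumes M: "\<And>n. prob_space (M n)" and W: "prob_space W" "sets W = sets borel"
    and Z: "conv_in_dist M Z W"
    and V: "\<forall>\<^sub>F n in sequentially. V n \<in> borel_measurable (M n)"
    and rep: "\<forall>\<^sub>F n in sequentially. \<forall>\<omega>\<in>space (M n).
                V n \<omega> = F (Z n \<omega>, E n \<omega>) \<and> dist (E n \<omega>) e \<le> D n \<omega>"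
    and D: "\<forall>\<^sub>F n in sequentially. integrable (M n) (D n)"
    and D0: "(\<lambda>n. \<integral>\<omega>. D n \<omega> \<partial>M n) \<longlonglongrightarrow> 0"
    and cont: "AE w in W. isCont F (w, e) \<and> g w = F (w, e)"
    and g: "g \<in> borel_measurable borel"
  shows "conv_in_dist M V (distr W borel g)"
  unfolding conv_in_dist_def
proof (intro conjI allI impI)
  show "\<forall>\<^sub>F n in sequentially. V n \<in> borel_measurable (M n)" by (rule V)
  fix f :: "'c \<Rightarrow> real" assume f: "continuous_on UNIV f \<and> bounded (range f)"
  then obtain B where B: "\<And>x. \<bar>f x\<bar> \<le> B" by (auto simp: bounded_iff)
  note low = liminf_integral_map[OF M W Z V rep D D0 cont g]
  have gW: "g \<in> measurable W borel" using g W(2) by (simp cong: measurable_cong_sets)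
  have fb: "f \<in> borel_measurable borel" using f by (intro borel_measurable_continuous_onI) auto
  have eq: "(\<integral>z. f z \<partial>distr W borel g) = (\<integral>w. f (g w) \<partial>W)"
    by (rule integral_distr[OF gW fb])
  show "(\<lambda>n. \<integral>\<omega>. f (V n \<omega>) \<partial>M n) \<longlonglongrightarrow> (\<integral>z. f z \<partial>distr W borel g)"
    unfolding eq
  proof (rule tendstoI)
    fix \<eta> :: real assume \<eta>: "\<eta> > 0"
    have "\<forall>\<^sub>F n in sequentially. (\<integral>w. f (g w) \<partial>W) - \<eta> < (\<integral>\<omega>. f (V n \<omega>) \<partial>M n)"
      by (rule low[where B = B]) (use f B \<eta> in auto)
    moreover have "\<forall>\<^sub>F n in sequentially. (\<integral>w. - f (g w) \<partial>W) - \<eta> < (\<integral>\<omega>. - f (V n \<omega>) \<partial>M n)"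
      by (rule low[where B = B]) (use f B \<eta> in \<open>auto intro: continuous_intros\<close>)
    ultimately show "\<forall>\<^sub>F n in sequentially. dist (\<integral>\<omega>. f (V n \<omega>) \<partial>M n) (\<integral>w. f (g w) \<partial>W) < \<eta>"
      by eventually_elim (simp add: dist_real_def abs_less_iff)
  qed
qed

section \<open>The lasso and the least squares estimator\<close>

lemma gram_mult: "gram n x *v v = (\<Sum>i\<in>{1..n}. (x i \<bullet> v) *\<^sub>R x i)"
proof -
  have "(gram n x *v v) $ j = (\<Sum>i\<in>{1..n}. (x i \<bullet> v) *\<^sub>R x i) $ j" for j
  proof -
    have "(gram n x *v v) $ j = (\<Sum>k\<in>UNIV. \<Sum>i\<in>{1..n}. x i $ j * x i $ k * v $ k)"
      by (simp add: gram_def matrix_vector_mult_def sum_distrib_right)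
    also have "\<dots> = (\<Sum>i\<in>{1..n}. \<Sum>k\<in>UNIV. x i $ j * x i $ k * v $ k)"
      by (rule sum.swap)
    also have "\<dots> = (\<Sum>i\<in>{1..n}. (x i \<bullet> v) *\<^sub>R x i) $ j"
      by (simp add: inner_vec_def sum_distrib_left sum_distrib_right mult_ac)
    finally show ?thesis .
  qed
  then show ?thesis by (simp add: vec_eq_iff)
qed

lemma transpose_gram: "transpose (gram n x) = gram n x"
  by (simp add: gram_def transpose_def mult.commute)

lemma pos_def_gram:
  fixes x :: "nat \<Rightarrow> real^'p"
  assumes "dim (x ` {1..n}) = CARD('p)"
  shows "pos_def (gram n x)"
  unfolding pos_def_def
proof (intro conjI allI impI transpose_gram)
  fix v :: "real^'p" assume v: "v \<noteq> 0"
  have q: "v \<bullet> (gram n x *v v) = (\<Sum>i\<in>{1..n}. (x i \<bullet> v)\<^sup>2)"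
    by (simp add: gram_mult inner_sum_right inner_commute power2_eq_square)
  have "(\<Sum>i\<in>{1..n}. (x i \<bullet> v)\<^sup>2) \<noteq> 0"
  proof
    assume "(\<Sum>i\<in>{1..n}. (x i \<bullet> v)\<^sup>2) = 0"
    then have "\<forall>i\<in>{1..n}. x i \<bullet> v = 0" by (simp add: sum_nonneg_eq_0_iff)
    then have orth: "\<And>u. u \<in> x ` {1..n} \<Longrightarrow> orthogonal v u"
      by (auto simp: orthogonal_def inner_commute)
    have "span (x ` {1..n}) = UNIV" using assms by (simp add: dim_eq_full[symmetric])
    then have "v \<in> span (x ` {1..n})" by simp
    then have "orthogonal v v" using orth by (rule orthogonal_to_span)
    then show False using v by (simp add: orthogonal_def)
  qed
  moreover have "0 \<le> (\<Sum>i\<in>{1..n}. (x i \<bullet> v)\<^sup>2)" by (simp add: sum_nonneg)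
  ultimately show "0 < v \<bullet> (gram n x *v v)" by (simp add: q)
qed

lemma normal_equations:
  assumes "pos_def (gram n x)"
  shows "gram n x *v ols n x y = (\<Sum>i\<in>{1..n}. y i *\<^sub>R x i)"
  unfolding ols_def
  by (simp add: matrix_vector_mul_assoc invertible_matrix_inv[OF pos_def_invertible[OF assms]])

lemma ols_exact_fit:
  assumes "pos_def (gram n x)"
  shows "ols n x (\<lambda>i. x i \<bullet> b) = b"
  unfolding ols_def gram_mult[symmetric]
  by (simp add: matrix_vector_mul_assoc invertible_matrix_inv[OF pos_def_invertible[OF assms]])

definition l1_norm :: "real^'p \<Rightarrow> real" where
  "l1_norm b = (\<Sum>j\<in>UNIV. \<bar>b $ j\<bar>)"

lemma l1_norm_convex: "l1_norm ((1/2) *\<^sub>R (a + b)) \<le> (l1_norm a + l1_norm b) / 2"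
  unfolding l1_norm_def sum.distrib[symmetric] sum_divide_distrib
  by (rule sum_mono) auto

lemma l1_norm_diff: "l1_norm a - l1_norm b \<le> l1_norm (a - b)"
  unfolding l1_norm_def sum_subtractf[symmetric] by (rule sum_mono) auto

lemma l1_norm_le: "l1_norm (b :: real^'p) \<le> CARD('p) * norm b"
proof -
  have "l1_norm b \<le> (\<Sum>j\<in>(UNIV::'p set). norm b)"
    unfolding l1_norm_def by (rule sum_mono) (rule component_le_norm_cart)
  then show ?thesis by simp
qed

lemma l1_norm_nonneg: "0 \<le> l1_norm b"
  unfolding l1_norm_def by (simp add: sum_nonneg)

lemma quadratic_form_diff:
  assumes "pos_def S"
  shows "(a - b) \<bullet> (S *v (a - b)) = a \<bullet> (S *v a) - 2 * (a \<bullet> (S *v b)) + b \<bullet> (S *v b)"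
  using pos_def_sym[OF assms, of b a]
  by (simp add: matrix_vector_mult_diff_distrib inner_diff_left inner_diff_right inner_commute)

text \<open>
  The cross term vanishes by the normal equations, so the objective depends on the data through the
  OLS estimator and an additive constant only.
\<close>

lemma lasso_obj_decomposition:
  assumes G: "pos_def (gram n x)"
  shows "lasso_obj n x y l b = (\<Sum>i\<in>{1..n}. (y i - x i \<bullet> ols n x y)\<^sup>2)
     + (b - ols n x y) \<bullet> (gram n x *v (b - ols n x y)) + l * l1_norm b"
proof -
  have sq: "(\<Sum>i\<in>{1..n}. (y i - x i \<bullet> b)\<^sup>2)
      = (\<Sum>i\<in>{1..n}. (y i)\<^sup>2) - 2 * (b \<bullet> (gram n x *v ols n x y)) + b \<bullet> (gram n x *v b)" for b
  proof -
    have "(\<Sum>i\<in>{1..n}. (y i - x i \<bullet> b)\<^sup>2)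
        = (\<Sum>i\<in>{1..n}. (y i)\<^sup>2 - 2 * (y i * (b \<bullet> x i)) + (x i \<bullet> b) * (b \<bullet> x i))"
      by (intro sum.cong refl) (simp add: power2_eq_square inner_commute algebra_simps)
    also have "\<dots> = (\<Sum>i\<in>{1..n}. (y i)\<^sup>2) - 2 * (\<Sum>i\<in>{1..n}. y i * (b \<bullet> x i))
        + (\<Sum>i\<in>{1..n}. (x i \<bullet> b) * (b \<bullet> x i))"
      by (simp add: sum.distrib sum_subtractf sum_distrib_left)
    moreover have "b \<bullet> (gram n x *v ols n x y) = (\<Sum>i\<in>{1..n}. y i * (b \<bullet> x i))"
      by (simp add: normal_equations[OF G] inner_sum_right)
    moreover have "b \<bullet> (gram n x *v b) = (\<Sum>i\<in>{1..n}. (x i \<bullet> b) * (b \<bullet> x i))"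
      by (simp add: gram_mult inner_sum_right)
    ultimately show ?thesis by simp
  qed
  show ?thesis
    unfolding lasso_obj_def l1_norm_def sq quadratic_form_diff[OF G] by simp
qed

text \<open>
  The choice made by \<^const>\<open>arg_min\<close> is a minimizer only because one exists: outside a ball around
  the OLS estimator the quadratic part alone exceeds the value at the centre, and the ball is compact.
\<close>

lemma lasso_minimizes:
  fixes x :: "nat \<Rightarrow> real^'p"
  assumes G: "pos_def (gram n x)" and l: "l \<ge> 0"
  shows "lasso_obj n x y l (lasso n x y l) \<le> lasso_obj n x y l b"
proof -
  obtain c where c: "c > 0" "\<And>v. c * (norm v)\<^sup>2 \<le> v \<bullet> (gram n x *v v)"
    using pos_def_lower_bound[OF G] by blast
  let ?f = "lasso_obj n x y l" and ?o = "ols n x y"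
  define r where "r = sqrt (l * l1_norm ?o / c)"
  have r2: "c * r\<^sup>2 = l * l1_norm ?o" and r0: "r \<ge> 0"
    using c(1) l l1_norm_nonneg[of ?o] by (simp_all add: r_def)
  have "continuous_on (cball ?o r) ?f"
    unfolding lasso_obj_def by (intro continuous_intros)
  moreover have "cball ?o r \<noteq> {}" using r0 by simp
  ultimately obtain m where m: "\<And>b. b \<in> cball ?o r \<Longrightarrow> ?f m \<le> ?f b"
    using continuous_attains_inf[OF compact_cball, of ?o r ?f] by blast
  have "?f m \<le> ?f b" for b
  proof (cases "b \<in> cball ?o r")
    case True then show ?thesis by (rule m)
  next
    case False
    then have "r \<le> norm (b - ?o)" by (simp add: dist_norm norm_minus_commute)
    then have "c * r\<^sup>2 \<le> c * (norm (b - ?o))\<^sup>2"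
      using c(1) r0 by (intro mult_left_mono power_mono) auto
    also have "\<dots> \<le> (b - ?o) \<bullet> (gram n x *v (b - ?o))" by (rule c(2))
    finally have "?f ?o \<le> ?f b"
      using mult_nonneg_nonneg[OF l l1_norm_nonneg[of b]]
      by (simp add: lasso_obj_decomposition[OF G] r2)
    moreover have "?f m \<le> ?f ?o" using m r0 by simp
    ultimately show ?thesis by linarith
  qed
  then have "is_arg_min ?f (\<lambda>_. True) m"
    by (simp add: is_arg_min_def not_less)
  then have "is_arg_min ?f (\<lambda>_. True) (lasso n x y l)"
    unfolding lasso_def arg_min_def by (rule someI)
  then show ?thesis by (simp add: is_arg_min_def not_less)
qed

text \<open>
  The objective at the midpoint of \<open>b\<close> and the minimizer is no smaller than the minimum, while the
  parallelogram identity and the convexity of the penalty put it a quarter of the quadratic form below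
  the average of the two values.
\<close>

lemma lasso_obj_growth:
  fixes x :: "nat \<Rightarrow> real^'p"
  assumes G: "pos_def (gram n x)" and l: "l \<ge> 0"
  shows "lasso_obj n x y l (lasso n x y l) + (1/2) * ((b - lasso n x y l) \<bullet> (gram n x *v (b - lasso n x y l)))
     \<le> lasso_obj n x y l b"
proof -
  let ?f = "lasso_obj n x y l" and ?L = "lasso n x y l" and ?S = "gram n x" and ?o = "ols n x y"
  let ?m = "(1/2) *\<^sub>R (b + ?L)"
  define u v where "u = b - ?o" and "v = ?L - ?o"
  have quad: "(?m - ?o) \<bullet> (?S *v (?m - ?o))
      = (u \<bullet> (?S *v u) + v \<bullet> (?S *v v)) / 2 - (1/4) * ((b - ?L) \<bullet> (?S *v (b - ?L)))"
  proof -
    have m: "?m - ?o = (1/2) *\<^sub>R (u + v)"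
      unfolding u_def v_def by (simp add: vec_eq_iff)
    have d: "b - ?L = u - v" unfolding u_def v_def by simp
    show ?thesis
      unfolding m d using pos_def_sym[OF G, of v u]
      by (simp add: matrix_vector_mult_scaleR matrix_vector_mult_diff_distrib matrix_vector_right_distrib
         inner_diff_left inner_diff_right inner_add_left inner_add_right inner_commute field_simps)
  qed
  have "?f ?L \<le> ?f ?m" by (rule lasso_minimizes[OF G l])
  moreover have "l * l1_norm ?m \<le> l * ((l1_norm b + l1_norm ?L) / 2)"
    by (intro mult_left_mono l1_norm_convex l)
  ultimately show ?thesis
    unfolding lasso_obj_decomposition[OF G] quad
    unfolding u_def[symmetric] v_def[symmetric] by (simp add: field_simps)
qed

text \<open>
  Add the growth inequalities for the two data sets, each evaluated at the minimizer of the other: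
  the penalties cancel and only the mixed quadratic term remains. The point of the lemma is that the
  lasso is a continuous, hence measurable, function of the OLS estimator.
\<close>

lemma lasso_lipschitz_in_ols:
  fixes x :: "nat \<Rightarrow> real^'p"
  assumes G: "pos_def (gram n x)" and l: "l \<ge> 0"
  obtains \<kappa> where "\<kappa> \<ge> 0" "\<And>y y'. norm (lasso n x y l - lasso n x y' l) \<le> \<kappa> * norm (ols n x y - ols n x y')"
proof -
  let ?S = "gram n x"
  obtain c where c: "c > 0" "\<And>v. c * (norm v)\<^sup>2 \<le> v \<bullet> (?S *v v)"
    using pos_def_lower_bound[OF G] by blast
  obtain K where K: "K > 0" "\<And>v. norm (?S *v v) \<le> norm v * K"
    using bounded_linear.pos_bounded[OF matrix_vector_mul_bounded_linear] by blast
  have "norm (lasso n x y l - lasso n x y' l) \<le> 2 * K / c * norm (ols n x y - ols n x y')" for y y'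
  proof -
    let ?L = "lasso n x y l" and ?L' = "lasso n x y' l" and ?o = "ols n x y" and ?o' = "ols n x y'"
    let ?d = "?L - ?L'"
    define q where "q a b = a \<bullet> (?S *v b)" for a b
    have q: "q (a - b) (a - b) = q a a - 2 * q a b + q b b"
      for a b unfolding q_def by (rule quadratic_form_diff[OF G])
    have q': "q a (b - d) = q a b - q a d" "q (a - b) d = q a d - q b d" for a b d
      unfolding q_def by (simp_all only: matrix_vector_mult_diff_distrib inner_diff_left inner_diff_right)
    have sym: "q ?L' ?L = q ?L ?L'"
      unfolding q_def using pos_def_sym[OF G] by (simp only: inner_commute)
    have "q ?L ?L - 2 * q ?L ?o + l * l1_norm ?L + (1/2) * q ?d ?d
        \<le> q ?L' ?L' - 2 * q ?L' ?o + l * l1_norm ?L'"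
      using lasso_obj_growth[OF G l, of y ?L']
      unfolding lasso_obj_decomposition[OF G] q_def[symmetric] q sym by argo
    moreover have "q ?L' ?L' - 2 * q ?L' ?o' + l * l1_norm ?L' + (1/2) * q ?d ?d
        \<le> q ?L ?L - 2 * q ?L ?o' + l * l1_norm ?L"
      using lasso_obj_growth[OF G l, of y' ?L]
      unfolding lasso_obj_decomposition[OF G] q_def[symmetric] q sym by argo
    ultimately have "q ?d ?d \<le> 2 * q ?d (?o - ?o')"
      unfolding q q' by argo
    then have le: "?d \<bullet> (?S *v ?d) \<le> 2 * (?d \<bullet> (?S *v (?o - ?o')))"
      by (simp only: q_def)
    have "c * (norm ?d)\<^sup>2 \<le> ?d \<bullet> (?S *v ?d)" by (rule c(2))
    also note le
    also have "?d \<bullet> (?S *v (?o - ?o')) \<le> norm ?d * norm (?S *v (?o - ?o'))"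
      by (rule norm_cauchy_schwarz)
    also have "\<dots> \<le> norm ?d * (norm (?o - ?o') * K)"
      by (intro mult_left_mono K) simp
    finally have *: "norm ?d * (c * norm ?d) \<le> norm ?d * (2 * K * norm (?o - ?o'))"
      by (simp add: power2_eq_square mult_ac)
    show ?thesis
    proof (cases "norm ?d = 0")
      case False
      then have "c * norm ?d \<le> 2 * K * norm (?o - ?o')"
        using * by (simp add: mult_le_cancel_left)
      then show ?thesis using c(1) by (simp add: field_simps)
    qed (use K(1) c(1) in simp)
  qed
  then show thesis using K(1) c(1) by (intro that[of "2 * K / c"]) auto
qed

text \<open>
  The OLS estimator minimizes the quadratic part, so what the lasso loses there it must gain in the
  penalty, which is at most \<open>l\<close> times the \<open>\<ell>\<^sup>1\<close> distance of the two estimators. A quadratic quantity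
  bounded by a linear one is small.
\<close>

lemma lasso_near_ols:
  fixes x :: "nat \<Rightarrow> real^'p"
  assumes G: "pos_def (gram n x)" and l: "l \<ge> 0"
    and c: "c > 0" "\<And>v. c * (norm v)\<^sup>2 \<le> v \<bullet> (gram n x *v v)"
  shows "norm (lasso n x y l - ols n x y) \<le> l * CARD('p) / c"
proof -
  let ?L = "lasso n x y l" and ?o = "ols n x y"
  let ?d = "?L - ?o"
  have "c * (norm ?d)\<^sup>2 \<le> ?d \<bullet> (gram n x *v ?d)" by (rule c(2))
  also have "\<dots> \<le> l * (l1_norm ?o - l1_norm ?L)"
    using lasso_minimizes[OF G l, of y ?o]
    unfolding lasso_obj_decomposition[OF G] by (simp add: algebra_simps)
  also have "\<dots> \<le> l * (CARD('p) * norm (?o - ?L))"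
    using l1_norm_diff[of ?o ?L] l1_norm_le[of "?o - ?L"] l by (intro mult_left_mono) auto
  finally have *: "norm ?d * (c * norm ?d) \<le> norm ?d * (l * CARD('p))"
    by (simp add: power2_eq_square mult_ac norm_minus_commute)
  show ?thesis
  proof (cases "norm ?d = 0")
    case False
    then have "c * norm ?d \<le> l * CARD('p)"
      using * by (simp add: mult_le_cancel_left)
    then show ?thesis using c(1) by (simp add: field_simps)
  qed (use l c(1) in simp)
qed

lemma borel_measurable_ols:
  fixes x :: "nat \<Rightarrow> real^'p"
  assumes "\<And>i. i \<in> {1..n} \<Longrightarrow> (\<lambda>\<omega>. Y \<omega> i) \<in> borel_measurable M"
  shows "(\<lambda>\<omega>. ols n x (Y \<omega>)) \<in> borel_measurable M"
  unfolding ols_def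
  by (intro borel_measurable_matrix_vector_mult borel_measurable_sum borel_measurable_scaleR
      borel_measurable_const assms)

lemma borel_measurable_lasso:
  fixes x :: "nat \<Rightarrow> real^'p"
  assumes G: "pos_def (gram n x)" and l: "l \<ge> 0"
    and Y: "\<And>i. i \<in> {1..n} \<Longrightarrow> (\<lambda>\<omega>. Y \<omega> i) \<in> borel_measurable M"
  shows "(\<lambda>\<omega>. lasso n x (Y \<omega>) l) \<in> borel_measurable M"
proof -
  obtain \<kappa> where \<kappa>: "\<kappa> \<ge> 0"
    "\<And>y y'. norm (lasso n x y l - lasso n x y' l) \<le> \<kappa> * norm (ols n x y - ols n x y')"
    using lasso_lipschitz_in_ols[OF G l] by blast
  (* The lasso with OLS estimator b, realized by the responses that b fits exactly. *)
  define \<psi> where "\<psi> b = lasso n x (\<lambda>i. x i \<bullet> b) l" for b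
  have "\<kappa>-lipschitz_on UNIV \<psi>"
  proof (rule lipschitz_onI)
    fix b b' :: "real^'p"
    show "dist (\<psi> b) (\<psi> b') \<le> \<kappa> * dist b b'"
      using \<kappa>(2)[of "\<lambda>i. x i \<bullet> b" "\<lambda>i. x i \<bullet> b'"]
      by (simp add: dist_norm \<psi>_def ols_exact_fit[OF G])
  qed (rule \<kappa>(1))
  then have cont: "continuous_on UNIV \<psi>" by (rule lipschitz_on_continuous_on)
  have "lasso n x y l = \<psi> (ols n x y)" for y
    using \<kappa>(2)[of y "\<lambda>i. x i \<bullet> ols n x y"] by (simp add: \<psi>_def ols_exact_fit[OF G])
  then have "(\<lambda>\<omega>. lasso n x (Y \<omega>) l) = (\<lambda>\<omega>. \<psi> (ols n x (Y \<omega>)))" by simp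
  also have "\<dots> \<in> borel_measurable M"
    by (rule borel_measurable_continuous_on[OF cont borel_measurable_ols[OF Y]])
  finally show ?thesis .
qed

section \<open>Consistency of the residual variance\<close>

text \<open>
  The substitution \<open>t = x / 2\<close> turns the Gamma integral into the moments of the chi-square law.
\<close>

lemma chi_square_moment:
  assumes m: "m \<ge> 1"
  shows "has_bochner_integral lborel (\<lambda>x. chi_square_density m x * x ^ j)
           (2 ^ j * Gamma (real m / 2 + real j) / Gamma (real m / 2))"
proof -
  define s where "s = real m / 2 + real j"
  have s: "s > 0" using m by (simp add: s_def add_pos_nonneg)
  define h where "h t = indicator {0..} t * t powr (s - 1) / exp t" for t :: real
  have "has_bochner_integral lborel h (Gamma s)"
    unfolding h_def
    by (rule has_bochner_integral_nn_integral)
       (use s Gamma_conv_nn_integral_real[OF s] Gamma_real_pos[OF s] in auto)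
  then have "has_bochner_integral lborel (\<lambda>x. h (0 + (1/2) * x)) (Gamma s /\<^sub>R \<bar>1/2\<bar>)"
    by (subst (asm) lborel_has_bochner_integral_real_affine_iff[where c = "1/2" and t = 0]) auto
  then have "has_bochner_integral lborel (\<lambda>x. 2 powr (s - 1) / (2 powr (real m / 2) * Gamma (real m / 2)) * h (0 + (1/2) * x))
      (2 powr (s - 1) / (2 powr (real m / 2) * Gamma (real m / 2)) * (Gamma s /\<^sub>R \<bar>1/2\<bar>))"
    by (rule has_bochner_integral_mult_right)
  moreover have "2 powr (s - 1) / (2 powr (real m / 2) * Gamma (real m / 2)) * h (0 + (1/2) * x)
      = chi_square_density m x * x ^ j" for x
  proof (cases "x > 0")
    case True
    have a: "2 powr (s - 1) * (x / 2) powr (s - 1) = x powr (s - 1)"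
      using True by (simp flip: powr_mult)
    have b: "x powr (s - 1) = x powr (real m / 2 - 1) * x ^ j"
    proof -
      have "s - 1 = (real m / 2 - 1) + real j" by (simp add: s_def)
      then show ?thesis using True by (simp only: powr_add powr_realpow)
    qed
    have c: "h (0 + (1/2) * x) = (x / 2) powr (s - 1) * exp (- x / 2)"
      using True by (simp add: h_def exp_minus inverse_eq_divide)
    have "2 powr (s - 1) / (2 powr (real m / 2) * Gamma (real m / 2)) * h (0 + (1/2) * x)
      = (2 powr (s - 1) * (x / 2) powr (s - 1)) * exp (- x / 2) / (2 powr (real m / 2) * Gamma (real m / 2))"
      unfolding c by (simp only: times_divide_eq_left times_divide_eq_right mult.assoc)
    also have "\<dots> = chi_square_density m x * x ^ j"
      unfolding a b using True by (simp add: chi_square_density_def)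
    finally show ?thesis .
  next
    case False
    then show ?thesis by (cases "x = 0") (auto simp: h_def chi_square_density_def indicator_def)
  qed
  moreover have "2 powr (s - 1) / (2 powr (real m / 2) * Gamma (real m / 2)) * (Gamma s /\<^sub>R \<bar>1/2\<bar>)
      = 2 ^ j * Gamma (real m / 2 + real j) / Gamma (real m / 2)"
  proof -
    have "2 powr s = 2 powr (real m / 2) * 2 ^ j"
      by (simp add: s_def powr_add powr_realpow)
    then have two: "2 powr (s - 1) * 2 = 2 powr (real m / 2) * 2 ^ j"
      by (simp add: powr_diff)
    have "2 powr (s - 1) / (2 powr (real m / 2) * Gamma (real m / 2)) * (Gamma s /\<^sub>R \<bar>1/2\<bar>)
        = (2 powr (s - 1) * 2) * Gamma s / (2 powr (real m / 2) * Gamma (real m / 2))"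
      by simp
    also have "\<dots> = 2 ^ j * Gamma s / Gamma (real m / 2)"
      unfolding two by simp
    finally show ?thesis by (simp only: s_def)
  qed
  ultimately show ?thesis by simp
qed

lemma chi_square_L2_concentration:
  assumes T: "distributed M lborel T (\<lambda>t. ennreal (chi_square_density m t))" and m: "m \<ge> 1"
  shows "integrable M (\<lambda>\<omega>. (T \<omega> / m - 1)\<^sup>2)" "(\<integral>\<omega>. (T \<omega> / m - 1)\<^sup>2 \<partial>M) = 2 / m"
proof -
  have a: "real m / 2 > 0" using m by simp
  have G0: "Gamma (real m / 2) > 0" using a by (rule Gamma_real_pos)
  have G1: "Gamma (real m / 2 + 1) = real m / 2 * Gamma (real m / 2)"
    using a by (intro Gamma_plus1) (auto elim!: nonpos_Ints_cases)
  have G2: "Gamma (real m / 2 + 2) = (real m / 2 + 1) * (real m / 2 * Gamma (real m / 2))"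
  proof -
    have "Gamma ((real m / 2 + 1) + 1) = (real m / 2 + 1) * Gamma (real m / 2 + 1)"
      using a by (intro Gamma_plus1) (auto elim!: nonpos_Ints_cases)
    moreover have "(real m / 2 + 1) + 1 = real m / 2 + 2" by simp
    ultimately show ?thesis unfolding G1 by metis
  qed
  note mom = chi_square_moment[OF m]
  have m0: "has_bochner_integral lborel (chi_square_density m) 1"
    using mom[of 0] G0 by simp
  have m1: "has_bochner_integral lborel (\<lambda>x. chi_square_density m x * x) m"
    using mom[of 1] G0 by (simp add: G1)
  have m2: "has_bochner_integral lborel (\<lambda>x. chi_square_density m x * x\<^sup>2) (real m * (real m + 2))"
  proof -
    have "2\<^sup>2 * ((a / 2 + 1) * (a / 2 * \<gamma>)) / \<gamma> = a * (a + 2)" if "\<gamma> \<noteq> 0" for a \<gamma> :: real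
      using that by (simp add: field_simps)
    from this[of "Gamma (real m / 2)" "real m"] G0
    have "2\<^sup>2 * Gamma (real m / 2 + real (2::nat)) / Gamma (real m / 2) = real m * (real m + 2)"
      unfolding of_nat_numeral G2 by linarith
    with mom[of 2] show ?thesis by (simp only:)
  qed
  have "has_bochner_integral lborel (\<lambda>x. chi_square_density m x * x\<^sup>2 / (real m)\<^sup>2
      - 2 / m * (chi_square_density m x * x) + chi_square_density m x)
      (real m * (real m + 2) / (real m)\<^sup>2 - 2 / m * m + 1)"
    by (intro has_bochner_integral_add has_bochner_integral_diff has_bochner_integral_mult_right
        has_bochner_integral_divide_zero m0 m1 m2)
  moreover have "chi_square_density m x * x\<^sup>2 / (real m)\<^sup>2
      - 2 / m * (chi_square_density m x * x) + chi_square_density m x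
      = chi_square_density m x * (x / m - 1)\<^sup>2" for x
    by (simp add: power2_diff power_divide algebra_simps)
  moreover have "real m * (real m + 2) / (real m)\<^sup>2 - 2 / m * m + 1 = 2 / m"
    using m by (simp add: power2_eq_square field_simps)
  ultimately have I: "has_bochner_integral lborel (\<lambda>x. chi_square_density m x * (x / m - 1)\<^sup>2) (2 / m)"
    by simp
  have nn: "chi_square_density m x \<ge> 0" for x
    using G0 by (simp add: chi_square_density_def)
  have Tr: "distributed M lborel T (chi_square_density m)" using T .
  have meas: "(\<lambda>x. (x / m - 1)\<^sup>2) \<in> borel_measurable lborel" by measurable
  show "integrable M (\<lambda>\<omega>. (T \<omega> / m - 1)\<^sup>2)"
    using distributed_integrable[OF Tr meas] nn I by (simp add: has_bochner_integral_iff)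
  show "(\<integral>\<omega>. (T \<omega> / m - 1)\<^sup>2 \<partial>M) = 2 / m"
    using distributed_integral[OF Tr meas] nn I by (simp add: has_bochner_integral_iff)
qed

text \<open>
  From \<open>|u| \<le> (sqrt m * u\<^sup>2 + 1 / sqrt m) / 2\<close> and the variance \<open>2 / m\<close>.
\<close>

lemma chi_square_L1_concentration:
  assumes M: "prob_space M" and T: "distributed M lborel T (\<lambda>t. ennreal (chi_square_density m t))" and m: "m \<ge> 1"
  shows "integrable M (\<lambda>\<omega>. \<bar>T \<omega> / m - 1\<bar>)" "(\<integral>\<omega>. \<bar>T \<omega> / m - 1\<bar> \<partial>M) \<le> 2 / sqrt m"
proof -
  interpret prob_space M by fact
  note C = chi_square_L2_concentration[OF T m]
  have meas: "T \<in> borel_measurable M" using T by (simp add: distributed_def)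
  have am_gm: "\<bar>u\<bar> \<le> (sqrt m * u\<^sup>2 + 1 / sqrt m) / 2" for u :: real
  proof -
    have "0 \<le> (\<bar>u\<bar> * sqrt m - 1)\<^sup>2" by simp
    also have "\<dots> = sqrt m * (sqrt m * u\<^sup>2 + 1 / sqrt m - 2 * \<bar>u\<bar>)"
      using m by (simp add: power2_diff power_mult_distrib power2_eq_square algebra_simps)
    finally show ?thesis using m by (simp add: zero_le_mult_iff)
  qed
  have dom: "integrable M (\<lambda>\<omega>. (sqrt m * (T \<omega> / m - 1)\<^sup>2 + 1 / sqrt m) / 2)"
    using C(1) by simp
  show int: "integrable M (\<lambda>\<omega>. \<bar>T \<omega> / m - 1\<bar>)"
    by (rule Bochner_Integration.integrable_bound[OF dom])
       (use meas am_gm in \<open>auto intro!: AE_I2 order_trans[OF am_gm abs_ge_self]\<close>)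
  have "(\<integral>\<omega>. \<bar>T \<omega> / m - 1\<bar> \<partial>M) \<le> (\<integral>\<omega>. (sqrt m * (T \<omega> / m - 1)\<^sup>2 + 1 / sqrt m) / 2 \<partial>M)"
    by (rule integral_mono[OF int dom]) (rule am_gm)
  also have "\<dots> = (sqrt m * (2 / m) + 1 / sqrt m) / 2"
    using C by (simp add: prob_space)
  also have "sqrt m * (2 / m) = 2 / sqrt m"
    using m by (simp add: field_simps)
  also have "(2 / sqrt m + 1 / sqrt m) / 2 \<le> 2 / sqrt m"
    using m by (simp add: field_simps)
  finally show "(\<integral>\<omega>. \<bar>T \<omega> / m - 1\<bar> \<partial>M) \<le> 2 / sqrt m" .
qed

section \<open>The estimators in local coordinates\<close>

text \<open>
  The coefficient matrix of the restricted estimator is homogeneous of degree 0 in the Gram matrix, so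
  the latter may be replaced by its normalized version, which has a limit.
\<close>

lemma rescaled_gram_inverses:
  fixes x :: "nat \<Rightarrow> real^'p" and H :: "real^'p^'q"
  assumes P: "pos_def (gram n x)" and n: "n \<ge> 1" and H: "rank H = CARD('q)"
  defines "S \<equiv> matrix_inv ((1 / real n) *\<^sub>R gram n x)"
  defines "K \<equiv> matrix_inv (H ** S ** transpose H)"
  shows "matrix_inv (gram n x) = (1 / real n) *\<^sub>R S"
    and "matrix_inv (H ** matrix_inv (gram n x) ** transpose H) = real n *\<^sub>R K"
    and "matrix_inv (gram n x) ** transpose H ** matrix_inv (H ** matrix_inv (gram n x) ** transpose H)
           = S ** transpose H ** K"
proof -
  have inv: "invertible (gram n x)" by (rule pos_def_invertible[OF P])
  have n0: "real n \<noteq> 0" "1 / real n > 0" using n by auto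
  show 1: "matrix_inv (gram n x) = (1 / real n) *\<^sub>R S"
    unfolding S_def using n0 by (subst matrix_inv_scaleR[OF inv]) auto
  have "pos_def S"
    unfolding S_def by (intro pos_def_matrix_inv pos_def_scaleR P n0)
  then have "pos_def (H ** S ** transpose H)" using H by (rule pos_def_congruence)
  then have inv': "invertible (H ** S ** transpose H)" by (rule pos_def_invertible)
  have "H ** matrix_inv (gram n x) ** transpose H = (1 / real n) *\<^sub>R (H ** S ** transpose H)"
    unfolding 1 by (simp add: matrix_scalar_ac scalar_matrix_assoc)
  then show 2: "matrix_inv (H ** matrix_inv (gram n x) ** transpose H) = real n *\<^sub>R K"
    unfolding K_def using n0 by (simp add: matrix_inv_scaleR[OF inv'])
  show "matrix_inv (gram n x) ** transpose H ** matrix_inv (H ** matrix_inv (gram n x) ** transpose H)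
      = S ** transpose H ** K"
    unfolding 2 unfolding 1 using n0 by (simp add: matrix_scalar_ac scalar_matrix_assoc[symmetric])
qed

text \<open>
  The Wald statistic in local coordinates, with \<open>K\<close> in the place of \<open>(H C\<inverse> H\<^sup>T)\<inverse>\<close> and \<open>s\<close> in that of
  \<open>\<sigma>\<^sup>2\<close>.
\<close>

definition wald :: "real^'p^'q \<Rightarrow> real^'q \<Rightarrow> real^'q^'q \<Rightarrow> real \<Rightarrow> real^'p \<Rightarrow> real" where
  "wald H \<xi> K s z = ((H *v z + \<xi>) \<bullet> (K *v (H *v z + \<xi>))) / s"

text \<open>
  Under the local alternative, \<open>\<surd>n (H b - h) = H (\<surd>n (b - \<beta>)) + \<xi>\<close> for every \<open>b\<close>; the powers of \<open>n\<close> in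
  the test statistic cancel. So the rescaled estimators depend on \<open>n\<close> through quantities that have a
  limit.
\<close>

lemma estimators_in_local_coordinates:
  fixes x :: "nat \<Rightarrow> real^'p" and H :: "real^'p^'q" and \<beta> :: "real^'p"
    and h \<xi> :: "real^'q" and y :: "nat \<Rightarrow> real" and l :: real
  assumes P: "pos_def (gram n x)" and n: "n \<ge> 1" and H: "rank H = CARD('q)"
    and local_alt: "H *v \<beta> = h + (1 / sqrt (real n)) *\<^sub>R \<xi>"
  defines "S \<equiv> matrix_inv ((1 / real n) *\<^sub>R gram n x)"
  defines "K \<equiv> matrix_inv (H ** S ** transpose H)"
  defines "B \<equiv> S ** transpose H ** K"
  defines "z \<equiv> sqrt (real n) *\<^sub>R (ols n x y - \<beta>)"
  defines "w \<equiv> sqrt (real n) *\<^sub>R (lasso n x y l - \<beta>)"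
  defines "u \<equiv> B *v (H *v w + \<xi>)"
  defines "T \<equiv> wald H \<xi> K (resid_var n x y) z"
  shows "sqrt (real n) *\<^sub>R (H *v lasso n x y l - h) = H *v w + \<xi>"
    and "sqrt (real n) *\<^sub>R (restricted_lasso n x y l H h - \<beta>) = w - u"
    and "sqrt (real n) *\<^sub>R (lasso n x y l - restricted_lasso n x y l H h) = u"
    and "sqrt (real n) *\<^sub>R (stein_lasso n x y l H h - \<beta>) = w - (stein_const n H / T) *\<^sub>R u"
    and "sqrt (real n) *\<^sub>R (pos_stein_lasso n x y l H h - \<beta>)
       = w - u + ((1 - stein_const n H / T) * of_bool (T > stein_const n H)) *\<^sub>R u"
proof -
  note I = rescaled_gram_inverses[OF P n H, folded S_def, folded K_def B_def]
  let ?r = "sqrt (real n)"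
  have r: "?r > 0" using n by simp
  have loc: "?r *\<^sub>R (H *v b - h) = H *v (?r *\<^sub>R (b - \<beta>)) + \<xi>" for b
  proof -
    have "H *v b - h = H *v (b - \<beta>) + (1 / ?r) *\<^sub>R \<xi>"
      using local_alt by (simp add: matrix_vector_mult_diff_distrib)
    then show ?thesis using r by (simp add: scaleR_right_distrib matrix_vector_mult_scaleR)
  qed
  show 1: "?r *\<^sub>R (H *v lasso n x y l - h) = H *v w + \<xi>"
    unfolding w_def by (rule loc)
  have RL: "restricted_lasso n x y l H h = lasso n x y l - B *v (H *v lasso n x y l - h)"
    unfolding restricted_lasso_def Let_def I(3) ..
  show 3: "?r *\<^sub>R (lasso n x y l - restricted_lasso n x y l H h) = u"
    unfolding RL u_def 1[symmetric] by (simp add: matrix_vector_mult_scaleR)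
  have split: "?r *\<^sub>R (restricted_lasso n x y l H h - \<beta>)
      = w - ?r *\<^sub>R (lasso n x y l - restricted_lasso n x y l H h)"
    unfolding w_def by (simp add: algebra_simps)
  then show 2: "?r *\<^sub>R (restricted_lasso n x y l H h - \<beta>) = w - u"
    unfolding 3 .
  have T: "test_stat n x y H h = T"
  proof -
    let ?d = "H *v ols n x y - h"
    have d: "?d = (1 / ?r) *\<^sub>R (H *v z + \<xi>)"
      unfolding z_def loc[symmetric] using r by simp
    have "?d \<bullet> ((real n *\<^sub>R K) *v ?d) = (H *v z + \<xi>) \<bullet> (K *v (H *v z + \<xi>))"
      unfolding d using n
      by (simp add: matrix_vector_mult_scaleR scaleR_matrix_vector_assoc[symmetric] power2_eq_square[symmetric])
    then show ?thesis
      unfolding test_stat_def Let_def I(2) T_def wald_def by simp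
  qed
  have "?r *\<^sub>R (stein_lasso n x y l H h - \<beta>)
      = w - (stein_const n H / T) *\<^sub>R (?r *\<^sub>R (lasso n x y l - restricted_lasso n x y l H h))"
    unfolding stein_lasso_def T w_def by (simp add: algebra_simps)
  then show "?r *\<^sub>R (stein_lasso n x y l H h - \<beta>) = w - (stein_const n H / T) *\<^sub>R u"
    unfolding 3 .
  have "?r *\<^sub>R (pos_stein_lasso n x y l H h - \<beta>)
      = ?r *\<^sub>R (restricted_lasso n x y l H h - \<beta>) + ((1 - stein_const n H / T) * of_bool (T > stein_const n H))
         *\<^sub>R (?r *\<^sub>R (lasso n x y l - restricted_lasso n x y l H h))"
    unfolding pos_stein_lasso_def T by (simp add: algebra_simps)
  then show "?r *\<^sub>R (pos_stein_lasso n x y l H h - \<beta>)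
       = w - u + ((1 - stein_const n H / T) * of_bool (T > stein_const n H)) *\<^sub>R u"
    unfolding 3 2 .
qed

text \<open>
  \<open>Q\<close> is the projection along the kernel of \<open>H\<close> that is orthogonal for the inner product given by
  \<open>C\<close>; it is idempotent because the middle factors of \<open>Q Q\<close> cancel.
\<close>

lemma restriction_projection:
  fixes C :: "real^'p^'p" and H :: "real^'p^'q"
  assumes C: "pos_def C" and H: "rank H = CARD('q)"
  defines "S \<equiv> matrix_inv C"
  defines "G \<equiv> S ** transpose H ** matrix_inv (H ** S ** transpose H)"
  defines "Q \<equiv> G ** H"
  shows "S ** transpose Q = Q ** S" "Q ** S ** transpose Q = Q ** S"
proof -
  let ?K = "matrix_inv (H ** S ** transpose H)"
  have S: "pos_def S" unfolding S_def by (rule pos_def_matrix_inv[OF C])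
  have HSH: "pos_def (H ** S ** transpose H)" by (rule pos_def_congruence[OF S H])
  have sS: "transpose S = S" and sK: "transpose ?K = ?K"
    using S pos_def_matrix_inv[OF HSH] by (auto simp: pos_def_def)
  show 1: "S ** transpose Q = Q ** S"
    unfolding Q_def G_def by (simp add: matrix_transpose_mul sS sK matrix_mul_assoc)
  have "Q ** Q = S ** transpose H ** (?K ** (H ** S ** transpose H)) ** ?K ** H"
    unfolding Q_def G_def by (simp only: matrix_mul_assoc)
  also have "\<dots> = Q"
    unfolding invertible_matrix_inv(2)[OF pos_def_invertible[OF HSH]] Q_def G_def by simp
  finally have "Q ** Q = Q" .
  then show "Q ** S ** transpose Q = Q ** S"
    by (simp add: matrix_mul_assoc[symmetric] 1) (simp add: matrix_mul_assoc)
qed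

text \<open>
  A single nonzero row of \<open>H\<close> suffices: the corresponding coordinate has a normal law with positive
  variance, and such a law has no atoms.
\<close>

lemma AE_normal_affine_nonzero:
  fixes H :: "real^'p^'q"
  assumes W: "normal_law 0 S W" and S: "pos_def S" and H: "rank H = CARD('q)"
  shows "AE w in W. H *v w + \<xi> \<noteq> 0"
proof -
  note D = normal_lawD[OF W]
  obtain j :: 'q where True by simp
  define t where "t = transpose H *v axis j 1"
  have "rank (transpose H) = CARD('q)" using H by (simp add: rank_transpose)
  then have "inj ((*v) (transpose H))" using full_rank_injective by blast
  then have "t \<noteq> 0" unfolding t_def by (metis axis_eq_0_iff injD matrix_vector_mult_0_right zero_neq_one)
  then have v: "t \<bullet> (S *v t) > 0" using S pos_def_def by blast
  have "AE y in normal_measure 0 (t \<bullet> (S *v t)). y \<noteq> - \<xi> $ j"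
  proof -
    have "normal_measure 0 (t \<bullet> (S *v t))
        = density lborel (\<lambda>x. ennreal (normal_density 0 (sqrt (t \<bullet> (S *v t))) x))"
      using v by (simp add: normal_measure_def)
    then show ?thesis
      using AE_lborel_singleton[of "- \<xi> $ j"] by (simp only:) (subst AE_density, auto elim: eventually_mono)
  qed
  then have ae: "AE y in distr W borel (\<lambda>x. t \<bullet> x). y \<noteq> - \<xi> $ j"
    unfolding D(5)[of t] inner_zero_right .
  have "(\<lambda>x. t \<bullet> x) \<in> measurable W borel"
    using D(3) by (simp cong: measurable_cong_sets)
  then have "AE w in W. t \<bullet> w \<noteq> - \<xi> $ j" using ae by (rule AE_distrD)
  then show ?thesis
  proof eventually_elim
    case (elim w)
    have "t \<bullet> w = (H *v w) $ j"
      unfolding t_def inner_matrix_transpose[symmetric] by (simp add: inner_axis')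
    then show ?case using elim by (auto simp: vec_eq_iff add_eq_0_iff2)
  qed
qed

lemma wald_pos:
  assumes "pos_def K" "s > 0" "H *v w + \<xi> \<noteq> 0"
  shows "wald H \<xi> K s w > 0"
  using assms unfolding wald_def pos_def_def by simp

lemma tendsto_block_vec:
  fixes f :: "'x \<Rightarrow> real^'a" and g :: "'x \<Rightarrow> real^'b"
  assumes "(f \<longlongrightarrow> a) F" "(g \<longlongrightarrow> b) F"
  shows "((\<lambda>x. block_vec (f x) (g x)) \<longlongrightarrow> block_vec a b) F"
proof (rule vec_tendstoI)
  fix i show "((\<lambda>x. block_vec (f x) (g x) $ i) \<longlongrightarrow> block_vec a b $ i) F"
    by (cases i) (auto intro: tendsto_vec_nth assms)
qed

lemma tendsto_wald:
  fixes K :: "'x \<Rightarrow> real^'q^'q" and z :: "'x \<Rightarrow> real^'p"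
  assumes "(K \<longlongrightarrow> K0) F" "(s \<longlongrightarrow> s0) F" "s0 \<noteq> 0" "(z \<longlongrightarrow> z0) F"
  shows "((\<lambda>x. wald H \<xi> (K x) (s x) (z x)) \<longlongrightarrow> wald H \<xi> K0 s0 z0) F"
  unfolding wald_def
  by (intro tendsto_divide tendsto_inner tendsto_add tendsto_matrix_vector_mult tendsto_const assms)

text \<open>
  The factor that multiplies the indicator vanishes where the indicator jumps, so for positive \<open>T\<close> the
  product is the continuous function \<open>max 0 (1 - \<kappa> / T)\<close>.
\<close>

lemma tendsto_positive_part_factor:
  fixes T :: "'x \<Rightarrow> real"
  assumes T: "(T \<longlongrightarrow> T0) F" and "T0 > 0" and \<kappa>: "(\<kappa> \<longlongrightarrow> \<kappa>0) F"
  shows "((\<lambda>x. (1 - \<kappa> x / T x) * of_bool (T x > \<kappa> x)) \<longlongrightarrow> (1 - \<kappa>0 / T0) * of_bool (T0 > \<kappa>0)) F"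
proof -
  have eq: "(1 - k / t) * of_bool (t > k) = max 0 (1 - k / t)" if "t > 0" for k t :: real
    using that by (auto simp: max_def field_simps)
  have "((\<lambda>x. max 0 (1 - \<kappa> x / T x)) \<longlongrightarrow> max 0 (1 - \<kappa>0 / T0)) F"
    using \<open>T0 > 0\<close> by (intro tendsto_max tendsto_intros T \<kappa>) auto
  moreover have "\<forall>\<^sub>F x in F. max 0 (1 - \<kappa> x / T x) = (1 - \<kappa> x / T x) * of_bool (T x > \<kappa> x)"
    using order_tendstoD(1)[OF T \<open>T0 > 0\<close>] by eventually_elim (simp only: eq)
  ultimately show ?thesis
    unfolding eq[OF \<open>T0 > 0\<close>] by (rule Lim_transform_eventually)
qed

lemma scaleR_block_mat: "c *\<^sub>R block_mat P Q R S = block_mat (c *\<^sub>R P) (c *\<^sub>R Q) (c *\<^sub>R R) (c *\<^sub>R S)"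
  by (simp add: vec_eq_iff block_mat_def split: sum.split)

lemma centered_normal_exists:
  fixes S :: "real^'d^'d"
  assumes "pos_def S"
  obtains W where "normal_law 0 S W"
proof -
  obtain B :: "real^'d^'d" where B: "S = B ** transpose B"
    by (rule pos_def_factorization[OF assms])
  obtain N :: "(real^'d) measure" where N: "normal_law 0 (mat 1) N" by (rule std_gaussian_exists)
  have "normal_law 0 S (distr N borel (\<lambda>x. B *v x + 0))"
    using normal_law_matrix_image[OF N, of B 0] unfolding B[symmetric] matrix_mul_rid by simp
  then show thesis by (rule that)
qed

lemma dist_Pair_le: "dist (a, b) (c, d) \<le> dist a c + dist b d"
  unfolding dist_Pair_Pair by (rule sqrt_sum_squares_le_sum) auto

lemma stein_const_tendsto:
  fixes H :: "real^'p^'q"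
  shows "(\<lambda>n. stein_const n H) \<longlonglongrightarrow> real CARD('q) - 2"
proof -
  let ?c = "real CARD('q) - 2" and ?p = "real CARD('p)"
  have "filterlim (\<lambda>n. (2 - ?p) + real n) at_top sequentially"
    by (rule filterlim_tendsto_add_at_top[OF tendsto_const filterlim_real_sequentially])
  then have "(\<lambda>n. ?c - 2 * ?c / ((2 - ?p) + real n)) \<longlonglongrightarrow> ?c - 0"
    by (intro tendsto_diff tendsto_const tendsto_divide_0[OF tendsto_const] filterlim_at_top_imp_at_infinity)
  then have lim: "(\<lambda>n. ?c - 2 * ?c / ((2 - ?p) + real n)) \<longlonglongrightarrow> ?c" by simp
  have "\<forall>\<^sub>F n in sequentially. ?c - 2 * ?c / ((2 - ?p) + real n) = stein_const n H"
    using eventually_gt_at_top[of "CARD('p)"]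
  proof eventually_elim
    case (elim n)
    then have "(2 - ?p) + real n > 0" by simp
    then show ?case by (simp add: stein_const_def Let_def field_simps)
  qed
  with lim show ?thesis by (rule Lim_transform_eventually)
qed

section \<open>Asymptotic laws under local alternatives\<close>

theorem theorem5:
  fixes M :: "nat \<Rightarrow> 'w measure"
    and X :: "nat \<Rightarrow> nat \<Rightarrow> real^'p"
    and Y \<epsilon> :: "nat \<Rightarrow> 'w \<Rightarrow> nat \<Rightarrow> real"
    and \<beta> :: "nat \<Rightarrow> real^'p"
    and \<sigma> k :: real
    and C A :: "real^'p^'p"
    and H :: "real^'p^'q"
    and h \<xi> :: "real^'q"
    and lam :: "nat \<Rightarrow> real"
    and \<delta> :: "real^'p"
    and G :: "real^'q^'p"
    and LL :: "real^'p \<Rightarrow> real"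
  assumes prob: "\<And>n. prob_space (M n)"
    and sigma_pos: "\<sigma> > 0"
    and model: "\<And>n \<omega> i. \<omega> \<in> space (M n) \<Longrightarrow> i \<in> {1..n} \<Longrightarrow> Y n \<omega> i = X n i \<bullet> \<beta> n + \<epsilon> n \<omega> i"
    and err_mean: "\<And>n i. i \<in> {1..n} \<Longrightarrow>
          integrable (M n) (\<lambda>\<omega>. \<epsilon> n \<omega> i) \<and> (\<integral>\<omega>. \<epsilon> n \<omega> i \<partial>M n) = 0"
    and err_cov: "\<And>n i j. i \<in> {1..n} \<Longrightarrow> j \<in> {1..n} \<Longrightarrow>
          integrable (M n) (\<lambda>\<omega>. \<epsilon> n \<omega> i * \<epsilon> n \<omega> j) \<and>
          (\<integral>\<omega>. \<epsilon> n \<omega> i * \<epsilon> n \<omega> j \<partial>M n) = (if i = j then \<sigma>\<^sup>2 else 0)"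
    and full_rank: "\<And>n. n > CARD('p) \<Longrightarrow> dim (X n ` {1..n}) = CARD('p)"
    and ols_normal: "\<And>n. n > CARD('p) \<Longrightarrow>
          normal_law (\<beta> n) (\<sigma>\<^sup>2 *\<^sub>R matrix_inv (gram n (X n)))
            (distr (M n) borel (\<lambda>\<omega>. ols n (X n) (Y n \<omega>)))"
    and resid_chi_square: "\<And>n. n > CARD('p) \<Longrightarrow>
          distributed (M n) lborel
            (\<lambda>\<omega>. (real n - real CARD('p)) * resid_var n (X n) (Y n \<omega>) / \<sigma>\<^sup>2)
            (\<lambda>t. ennreal (chi_square_density (n - CARD('p)) t))"
    and ols_resid_indep: "\<And>n. n > CARD('p) \<Longrightarrow>
          indep_rv (M n)
            (\<lambda>\<omega>. ols n (X n) (Y n \<omega>))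
            (\<lambda>\<omega>. (real n - real CARD('p)) * resid_var n (X n) (Y n \<omega>) / \<sigma>\<^sup>2)"
    and A1: "(\<lambda>n. Max ((\<lambda>i. X n i \<bullet> (matrix_inv (gram n (X n)) *v X n i)) ` {1..n}))
               \<longlonglongrightarrow> 0"
    and A2: "(\<lambda>n. (1 / real n) *\<^sub>R gram n (X n)) \<longlonglongrightarrow> C" "pos_def C"
    and rank_H: "rank H = CARD('q)"
    and local_alt: "\<And>n. n \<ge> 1 \<Longrightarrow> H *v \<beta> n = h + (1 / sqrt (real n)) *\<^sub>R \<xi>"
    and lam_nonneg: "\<And>n. lam n \<ge> 0"
    and lam_small: "lam \<in> o(\<lambda>n. sqrt (real n))"
    and k_eq: "k = real CARD('q) - 2"
    and G_eq: "G = matrix_inv C ** transpose H **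
                     matrix_inv (H ** matrix_inv C ** transpose H)"
    and delta_eq: "\<delta> = G *v \<xi>"
    and A_eq: "A = matrix_inv C - G ** H ** matrix_inv C"
    and LL_eq: "\<And>w. LL w =
          ((H *v w + \<xi>) \<bullet> (matrix_inv (H ** matrix_inv C ** transpose H) *v (H *v w + \<xi>))) / \<sigma>\<^sup>2"
  defines "W1 \<equiv> \<lambda>n \<omega>. sqrt (real n) *\<^sub>R (lasso n (X n) (Y n \<omega>) (lam n) - \<beta> n)"
    and "W2 \<equiv> \<lambda>n \<omega>. sqrt (real n) *\<^sub>R (restricted_lasso n (X n) (Y n \<omega>) (lam n) H h - \<beta> n)"
    and "W3 \<equiv> \<lambda>n \<omega>. sqrt (real n) *\<^sub>R
                (lasso n (X n) (Y n \<omega>) (lam n) - restricted_lasso n (X n) (Y n \<omega>) (lam n) H h)"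
    and "W4 \<equiv> \<lambda>n \<omega>. sqrt (real n) *\<^sub>R (H *v lasso n (X n) (Y n \<omega>) (lam n) - h)"
  shows "\<exists>W. normal_law 0 (\<sigma>\<^sup>2 *\<^sub>R matrix_inv C) W
    \<and> conv_in_dist M (\<lambda>n \<omega>. sqrt (real n) *\<^sub>R (ols n (X n) (Y n \<omega>) - \<beta> n)) W
    \<and> conv_in_dist M W1 W
    \<and> conv_normal M W2 (- \<delta>) (\<sigma>\<^sup>2 *\<^sub>R A)
    \<and> conv_normal M W3 \<delta> (\<sigma>\<^sup>2 *\<^sub>R (matrix_inv C - A))
    \<and> conv_normal M W4 \<xi> (\<sigma>\<^sup>2 *\<^sub>R (H ** matrix_inv C ** transpose H))
    \<and> conv_normal M (\<lambda>n \<omega>. block_vec (W1 n \<omega>) (W3 n \<omega>)) (block_vec 0 \<delta>)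
        (\<sigma>\<^sup>2 *\<^sub>R block_mat (matrix_inv C) (matrix_inv C - A)
                        (matrix_inv C - A) (matrix_inv C - A))
    \<and> conv_normal M (\<lambda>n \<omega>. block_vec (W2 n \<omega>) (W3 n \<omega>)) (block_vec (- \<delta>) \<delta>)
        (\<sigma>\<^sup>2 *\<^sub>R block_mat A 0 0 (matrix_inv C - A))
    \<and> conv_normal M (\<lambda>n \<omega>. block_vec (W1 n \<omega>) (W4 n \<omega>)) (block_vec 0 \<xi>)
        (\<sigma>\<^sup>2 *\<^sub>R block_mat (matrix_inv C) (matrix_inv C ** transpose H)
                        (H ** matrix_inv C) (H ** matrix_inv C ** transpose H))
    \<and> conv_in_dist M
        (\<lambda>n \<omega>. sqrt (real n) *\<^sub>R (stein_lasso n (X n) (Y n \<omega>) (lam n) H h - \<beta> n))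
        (distr W borel (\<lambda>w. w - k *\<^sub>R ((1 / LL w) *\<^sub>R (G *v (H *v w + \<xi>)))))
    \<and> conv_in_dist M
        (\<lambda>n \<omega>. sqrt (real n) *\<^sub>R (pos_stein_lasso n (X n) (Y n \<omega>) (lam n) H h - \<beta> n))
        (distr W borel (\<lambda>w. w - k *\<^sub>R ((1 / LL w) *\<^sub>R (G *v (H *v w + \<xi>)))
           - ((1 - k / LL w) * of_bool (LL w < k)) *\<^sub>R (G *v (H *v w + \<xi>))))"
proof -
  interpret M: prob_space "M n" for n by (rule prob)
  let ?Ci = "matrix_inv C"
  have pC: "pos_def C" by (rule A2(2))
  have pCi: "pos_def ?Ci" by (rule pos_def_matrix_inv[OF pC])
  have pS: "pos_def (\<sigma>\<^sup>2 *\<^sub>R ?Ci)" using sigma_pos by (intro pos_def_scaleR pCi) simp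
  have pHCH: "pos_def (H ** ?Ci ** transpose H)" by (rule pos_def_congruence[OF pCi rank_H])
  define S where "S n = matrix_inv ((1 / real n) *\<^sub>R gram n (X n))" for n
  define K where "K n = matrix_inv (H ** S n ** transpose H)" for n
  define B where "B n = S n ** transpose H ** K n" for n
  define K0 where "K0 = matrix_inv (H ** ?Ci ** transpose H)"
  have pK0: "pos_def K0" unfolding K0_def by (rule pos_def_matrix_inv[OF pHCH])
  have S_lim: "S \<longlonglongrightarrow> ?Ci"
    unfolding S_def by (rule tendsto_matrix_inv[OF A2(1) pos_def_invertible[OF pC]])
  have K_lim: "K \<longlonglongrightarrow> K0"
    unfolding K_def K0_def
    by (intro tendsto_matrix_inv tendsto_matrix_mult tendsto_const S_lim pos_def_invertible pHCH)
  have B_lim: "B \<longlonglongrightarrow> G"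
    unfolding B_def G_eq K0_def[symmetric] by (intro tendsto_matrix_mult tendsto_const S_lim K_lim)

  define p where "p = CARD('p)"
  have pG: "pos_def (gram n (X n))" if "n > p" for n
    using full_rank[of n] that pos_def_gram unfolding p_def by blast
  have n1: "n \<ge> 1" if "n > p" for n using that by simp
  have ev_p: "\<forall>\<^sub>F n in sequentially. n > p" by (rule eventually_gt_at_top)

  define ols' where "ols' n \<omega> = ols n (X n) (Y n \<omega>)" for n \<omega>
  define las where "las n \<omega> = lasso n (X n) (Y n \<omega>) (lam n)" for n \<omega>
  define s2 where "s2 n \<omega> = resid_var n (X n) (Y n \<omega>)" for n \<omega>
  define Z where "Z n \<omega> = sqrt (real n) *\<^sub>R (ols' n \<omega> - \<beta> n)" for n \<omega>
  define \<Delta> where "\<Delta> n \<omega> = sqrt (real n) *\<^sub>R (las n \<omega> - ols' n \<omega>)" for n \<omega>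
  have mY: "(\<lambda>\<omega>. Y n \<omega> i) \<in> borel_measurable (M n)" if "i \<in> {1..n}" for n i
  proof -
    have "(\<lambda>\<omega>. X n i \<bullet> \<beta> n + \<epsilon> n \<omega> i) \<in> borel_measurable (M n)"
      using err_mean[OF that] by auto
    then show ?thesis using model[OF _ that] by (simp cong: measurable_cong)
  qed
  have mols [measurable]: "ols' n \<in> borel_measurable (M n)" for n
    unfolding ols'_def by (rule borel_measurable_ols[OF mY])
  have mlas: "las n \<in> borel_measurable (M n)" if "n > p" for n
    unfolding las_def by (rule borel_measurable_lasso[OF pG[OF that] lam_nonneg mY])
  have ms2 [measurable]: "s2 n \<in> borel_measurable (M n)" for n
    unfolding s2_def resid_var_def ols'_def[symmetric]
    by (intro borel_measurable_divide borel_measurable_sum borel_measurable_power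
        borel_measurable_diff borel_measurable_inner_const borel_measurable_const mY mols)
  have mZ: "Z n \<in> borel_measurable (M n)" for n unfolding Z_def by measurable

  (* The limit law, and the convergence of the OLS estimator to it. *)
  obtain W where W: "normal_law 0 (\<sigma>\<^sup>2 *\<^sub>R ?Ci) W" using centered_normal_exists[OF pS] by blast
  note DW = normal_lawD[OF W]
  have probW: "prob_space W" by (rule normal_law_prob_space[OF W])

  have Z_law: "normal_law 0 (\<sigma>\<^sup>2 *\<^sub>R S n) (distr (M n) borel (Z n))" if n: "n > p" for n
  proof -
    let ?N = "distr (M n) borel (\<lambda>\<omega>. ols n (X n) (Y n \<omega>))"
    let ?r = "sqrt (real n)"
    have r: "?r * ?r = real n" "real n \<noteq> 0" using n by auto
    have "normal_law ((?r *\<^sub>R mat 1) *v \<beta> n + - (?r *\<^sub>R \<beta> n))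
        ((?r *\<^sub>R mat 1) ** (\<sigma>\<^sup>2 *\<^sub>R matrix_inv (gram n (X n))) ** transpose (?r *\<^sub>R mat 1))
        (distr ?N borel (\<lambda>x. (?r *\<^sub>R mat 1) *v x + - (?r *\<^sub>R \<beta> n)))"
      using ols_normal[of n] n unfolding p_def by (intro normal_law_matrix_image)
    moreover have "(?r *\<^sub>R mat 1) *v \<beta> n + - (?r *\<^sub>R \<beta> n) = 0"
      by (simp add: scaleR_matrix_vector_assoc[symmetric])
    moreover have "(?r *\<^sub>R mat 1) ** (\<sigma>\<^sup>2 *\<^sub>R matrix_inv (gram n (X n))) ** transpose (?r *\<^sub>R mat 1)
        = \<sigma>\<^sup>2 *\<^sub>R S n"
    proof -
      have "(?r *\<^sub>R mat 1) ** (\<sigma>\<^sup>2 *\<^sub>R matrix_inv (gram n (X n))) ** transpose (?r *\<^sub>R mat 1)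
          = (?r * ?r * \<sigma>\<^sup>2) *\<^sub>R matrix_inv (gram n (X n))"
        by (simp add: transpose_scalar matrix_scalar_ac scalar_matrix_assoc[symmetric] mult_ac)
      then show ?thesis
        unfolding rescaled_gram_inverses(1)[OF pG[OF n] n1[OF n] rank_H, folded S_def] r(1)
        using r(2) by simp
    qed
    moreover have "distr ?N borel (\<lambda>x. (?r *\<^sub>R mat 1) *v x + - (?r *\<^sub>R \<beta> n)) = distr (M n) borel (Z n)"
      using mols[of n] unfolding Z_def ols'_def
      by (subst distr_distr) (auto simp: comp_def scaleR_matrix_vector_assoc[symmetric] algebra_simps)
    ultimately show ?thesis by simp
  qed
  have Z_conv: "conv_in_dist M Z W"
  proof (rule conv_in_dist_normal[OF prob _ _ W])
    show "\<forall>\<^sub>F n in sequentially. Z n \<in> borel_measurable (M n)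
        \<and> normal_law 0 (\<sigma>\<^sup>2 *\<^sub>R S n) (distr (M n) borel (Z n))"
      using ev_p by eventually_elim (simp add: mZ Z_law)
    show "(\<lambda>n. \<sigma>\<^sup>2 *\<^sub>R S n) \<longlonglongrightarrow> \<sigma>\<^sup>2 *\<^sub>R ?Ci" by (intro tendsto_intros S_lim)
  qed

  obtain c where c: "c > 0"
    "\<forall>\<^sub>F n in sequentially. \<forall>v. c * (norm v)\<^sup>2 \<le> v \<bullet> (((1 / real n) *\<^sub>R gram n (X n)) *v v)"
    using eventually_quadratic_lower_bound[OF A2] by blast
  (* The lasso differs from the OLS estimator by a deterministic o(1 / sqrt n). *)
  define d where "d n = lam n / sqrt (real n) * (real p / c)" for n
  have \<Delta>_le: "\<forall>\<^sub>F n in sequentially. \<forall>\<omega>. norm (\<Delta> n \<omega>) \<le> d n"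
    using ev_p c(2)
  proof eventually_elim
    case (elim n)
    have n0: "real n > 0" using elim(1) by simp
    have low: "real n * c * (norm v)\<^sup>2 \<le> v \<bullet> (gram n (X n) *v v)" for v
    proof -
      have "c * (norm v)\<^sup>2 \<le> (v \<bullet> (gram n (X n) *v v)) / real n"
        using elim(2)[rule_format, of v] by (simp add: scaleR_matrix_vector_assoc[symmetric])
      then show ?thesis using n0 by (simp add: field_simps)
    qed
    show ?case
    proof
      fix \<omega>
      have "norm (las n \<omega> - ols' n \<omega>) \<le> lam n * CARD('p) / (real n * c)"
        unfolding las_def ols'_def
        by (rule lasso_near_ols[OF pG[OF elim(1)] lam_nonneg _ low]) (use n0 c(1) in simp)
      then have "sqrt (real n) * norm (las n \<omega> - ols' n \<omega>) \<le> sqrt (real n) * (lam n * CARD('p) / (real n * c))"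
        by (rule mult_left_mono) simp
      then have "norm (\<Delta> n \<omega>) \<le> sqrt (real n) * (lam n * CARD('p) / (real n * c))"
        unfolding \<Delta>_def by simp
      also have "\<dots> = d n"
      proof -
        have "r * (a * q / ((r * r) * c)) = a / r * (q / c)" if "r > 0" for r a q :: real
          using that c(1) by (simp add: field_simps)
        from this[of "sqrt (real n)" "lam n" "real CARD('p)"] show ?thesis
          using n0 by (simp add: d_def p_def)
      qed
      finally show "norm (\<Delta> n \<omega>) \<le> d n" .
    qed
  qed
  have d_lim: "d \<longlonglongrightarrow> 0"
  proof -
    have "(\<lambda>n. lam n / sqrt (real n)) \<longlonglongrightarrow> 0" by (rule smalloD_tendsto[OF lam_small])
    then have "(\<lambda>n. lam n / sqrt (real n) * (real p / c)) \<longlonglongrightarrow> 0 * (real p / c)"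
      by (intro tendsto_intros)
    then show ?thesis unfolding d_def by simp
  qed

  have s2_int: "integrable (M n) (\<lambda>\<omega>. \<bar>s2 n \<omega> - \<sigma>\<^sup>2\<bar>)" "(\<integral>\<omega>. \<bar>s2 n \<omega> - \<sigma>\<^sup>2\<bar> \<partial>M n) \<le> \<sigma>\<^sup>2 * (2 / sqrt (real (n - p)))"
    if n: "n > p" for n
  proof -
    let ?T = "\<lambda>\<omega>. (real n - real CARD('p)) * resid_var n (X n) (Y n \<omega>) / \<sigma>\<^sup>2"
    have m: "n - p \<ge> 1" using n by simp
    have T: "distributed (M n) lborel ?T (\<lambda>t. ennreal (chi_square_density (n - p) t))"
      using resid_chi_square[of n] n by (simp add: p_def)
    have eq: "\<bar>s2 n \<omega> - \<sigma>\<^sup>2\<bar> = \<sigma>\<^sup>2 * \<bar>?T \<omega> / real (n - p) - 1\<bar>" for \<omega>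
    proof -
      have "real (n - p) = real n - real CARD('p)" "real (n - p) \<noteq> 0" using n by (auto simp: p_def)
      then have "?T \<omega> / real (n - p) = s2 n \<omega> / \<sigma>\<^sup>2" by (simp add: s2_def)
      then have "s2 n \<omega> - \<sigma>\<^sup>2 = \<sigma>\<^sup>2 * (?T \<omega> / real (n - p) - 1)"
        using sigma_pos by (simp add: right_diff_distrib)
      then show ?thesis by (simp add: abs_mult)
    qed
    note L = chi_square_L1_concentration[OF prob T m]
    show "integrable (M n) (\<lambda>\<omega>. \<bar>s2 n \<omega> - \<sigma>\<^sup>2\<bar>)"
      unfolding eq using L(1) by simp
    show "(\<integral>\<omega>. \<bar>s2 n \<omega> - \<sigma>\<^sup>2\<bar> \<partial>M n) \<le> \<sigma>\<^sup>2 * (2 / sqrt (real (n - p)))"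
      unfolding eq using L(2) by (simp only: integral_mult_right_zero) (intro mult_left_mono, auto)
  qed
  have s2_lim: "(\<lambda>n. \<integral>\<omega>. \<bar>s2 n \<omega> - \<sigma>\<^sup>2\<bar> \<partial>M n) \<longlonglongrightarrow> 0"
  proof (rule tendsto_sandwich[where f = "\<lambda>_. 0" and h = "\<lambda>n. \<sigma>\<^sup>2 * (2 / sqrt (real (n - p)))"])
    have "filterlim (\<lambda>n. sqrt (real (n - p))) at_top sequentially"
      by (intro filterlim_compose[OF sqrt_at_top] filterlim_compose[OF filterlim_real_sequentially]
          filterlim_minus_const_nat_at_top)
    then have "(\<lambda>n. \<sigma>\<^sup>2 * (2 / sqrt (real (n - p)))) \<longlonglongrightarrow> \<sigma>\<^sup>2 * 0"
      by (intro tendsto_mult tendsto_const tendsto_divide_0[OF tendsto_const] filterlim_at_top_imp_at_infinity)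
    then show "(\<lambda>n. \<sigma>\<^sup>2 * (2 / sqrt (real (n - p)))) \<longlonglongrightarrow> 0" by simp
    show "\<forall>\<^sub>F n in sequentially. (\<integral>\<omega>. \<bar>s2 n \<omega> - \<sigma>\<^sup>2\<bar> \<partial>M n) \<le> \<sigma>\<^sup>2 * (2 / sqrt (real (n - p)))"
      using ev_p by eventually_elim (rule s2_int(2))
    show "\<forall>\<^sub>F n in sequentially. 0 \<le> (\<integral>\<omega>. \<bar>s2 n \<omega> - \<sigma>\<^sup>2\<bar> \<partial>M n)" by simp
  qed simp

  define \<kappa> where "\<kappa> n = stein_const n H" for n
  have \<kappa>_lim: "\<kappa> \<longlonglongrightarrow> k" unfolding \<kappa>_def k_eq by (rule stein_const_tendsto)
  (* The nuisance quantities, their limit, and an integrable bound for their distance. *)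
  define E where "E n \<omega> = (\<Delta> n \<omega>, B n, K n, s2 n \<omega>, \<kappa> n)" for n \<omega>
  define e where "e = (0 :: real^'p, G, K0, \<sigma>\<^sup>2, k)"
  define D where "D n \<omega> = d n + (dist (B n) G + (dist (K n) K0 + (\<bar>s2 n \<omega> - \<sigma>\<^sup>2\<bar> + dist (\<kappa> n) k)))" for n \<omega>
  have E_le: "\<forall>\<^sub>F n in sequentially. \<forall>\<omega>. dist (E n \<omega>) e \<le> D n \<omega>"
    using \<Delta>_le
  proof eventually_elim
    case (elim n)
    have "dist (E n \<omega>) e \<le> dist (\<Delta> n \<omega>) 0 + (dist (B n) G + (dist (K n) K0 + (dist (s2 n \<omega>) (\<sigma>\<^sup>2) + dist (\<kappa> n) k)))" for \<omega>
      unfolding E_def e_def by (intro order_trans[OF dist_Pair_le] add_left_mono dist_Pair_le order_refl)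
    moreover have "dist (\<Delta> n \<omega>) 0 \<le> d n" for \<omega> using elim by simp
    ultimately show ?case unfolding D_def dist_real_def
      by (meson add_right_mono order_trans)
  qed
  have D_int: "\<forall>\<^sub>F n in sequentially. integrable (M n) (D n)"
    using ev_p by eventually_elim (simp add: D_def[abs_def] s2_int(1))
  have D_lim: "(\<lambda>n. \<integral>\<omega>. D n \<omega> \<partial>M n) \<longlonglongrightarrow> 0"
  proof -
    have "(\<lambda>n. d n + (dist (B n) G + (dist (K n) K0 + ((\<integral>\<omega>. \<bar>s2 n \<omega> - \<sigma>\<^sup>2\<bar> \<partial>M n) + dist (\<kappa> n) k))))
        \<longlonglongrightarrow> 0 + (0 + (0 + (0 + 0)))"
      using B_lim K_lim \<kappa>_lim by (intro tendsto_add d_lim s2_lim) (simp_all add: tendsto_dist_iff[symmetric])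
    moreover have "\<forall>\<^sub>F n in sequentially. d n + (dist (B n) G + (dist (K n) K0 + ((\<integral>\<omega>. \<bar>s2 n \<omega> - \<sigma>\<^sup>2\<bar> \<partial>M n) + dist (\<kappa> n) k)))
        = (\<integral>\<omega>. D n \<omega> \<partial>M n)"
      using ev_p by eventually_elim (simp add: D_def s2_int(1) M.prob_space)
    ultimately show ?thesis by (simp add: Lim_transform_eventually)
  qed
  have limit: "conv_in_dist M V (distr W borel g)"
    if "\<And>n. n > p \<Longrightarrow> V n \<in> borel_measurable (M n)"
      and "\<And>n \<omega>. n > p \<Longrightarrow> \<omega> \<in> space (M n) \<Longrightarrow> V n \<omega> = F (Z n \<omega>, E n \<omega>)"
      and "AE w in W. isCont F (w, e) \<and> g w = F (w, e)"
      and "g \<in> borel_measurable borel"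
    for V :: "nat \<Rightarrow> 'w \<Rightarrow> 'c::euclidean_space" and F g
  proof (rule conv_in_dist_map[OF prob probW DW(3) Z_conv _ _ D_int D_lim that(3,4)])
    show "\<forall>\<^sub>F n in sequentially. V n \<in> borel_measurable (M n)"
      using ev_p by eventually_elim (rule that(1))
    show "\<forall>\<^sub>F n in sequentially. \<forall>\<omega>\<in>space (M n).
        V n \<omega> = F (Z n \<omega>, E n \<omega>) \<and> dist (E n \<omega>) e \<le> D n \<omega>"
      using ev_p E_le by eventually_elim (simp add: that(2))
  qed

  define Q where "Q = G ** H"
  (* Up to the factor sigma^2, Q C^-1 is both the covariance of Q W and its cross covariance with W. *)
  have QC: "?Ci ** transpose Q = Q ** ?Ci" "Q ** ?Ci ** transpose Q = Q ** ?Ci"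
    using restriction_projection[OF pC rank_H, folded G_eq] unfolding Q_def by blast+
  have A: "A = ?Ci - Q ** ?Ci" and CA: "?Ci - A = Q ** ?Ci"
    unfolding A_eq Q_def by simp_all
  have GH: "G *v (H *v w + \<xi>) = Q *v w + \<delta>" for w
    unfolding Q_def delta_eq by (simp add: matrix_vector_right_distrib matrix_vector_mul_assoc)
  have LL: "LL w = wald H \<xi> K0 (\<sigma>\<^sup>2) w" for w
    unfolding LL_eq wald_def K0_def ..

  (* The building blocks as fixed functions of u = (z, Delta, B, K, s, kappa): the lasso error w',
     the violation d' of the restriction, the correction u' towards it and the test statistic T'. *)
  define w' where "w' u = fst u + fst (snd u)" for u :: "(real^'p) \<times> (real^'p) \<times> (real^'q^'p) \<times> (real^'q^'q) \<times> real \<times> real"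
  define d' where "d' u = H *v w' u + \<xi>" for u
  define u' where "u' u = fst (snd (snd u)) *v d' u" for u
  define T' where "T' u = wald H \<xi> (fst (snd (snd (snd u)))) (fst (snd (snd (snd (snd u))))) (fst u)"
    for u :: "(real^'p) \<times> (real^'p) \<times> (real^'q^'p) \<times> (real^'q^'q) \<times> real \<times> real"
  define \<kappa>' where "\<kappa>' u = snd (snd (snd (snd (snd u))))" for u :: "(real^'p) \<times> (real^'p) \<times> (real^'q^'p) \<times> (real^'q^'q) \<times> real \<times> real"
  have at_e: "w' (w, e) = w" "d' (w, e) = H *v w + \<xi>" "u' (w, e) = Q *v w + \<delta>" "T' (w, e) = LL w" "\<kappa>' (w, e) = k" for w
    by (simp_all add: w'_def d'_def u'_def T'_def \<kappa>'_def e_def GH LL)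
  have tw: "(w' \<longlongrightarrow> w' a) (at a)" for a
    unfolding w'_def by (intro tendsto_intros)
  have td: "(d' \<longlongrightarrow> d' a) (at a)" for a
    unfolding d'_def by (intro tendsto_intros tendsto_matrix_vector_mult tw)
  have tu: "(u' \<longlongrightarrow> u' a) (at a)" for a
    unfolding u'_def by (intro tendsto_matrix_vector_mult td tendsto_intros)
  have t\<kappa>: "(\<kappa>' \<longlongrightarrow> \<kappa>' a) (at a)" for a
    unfolding \<kappa>'_def by (intro tendsto_intros)
  have tT: "(T' \<longlongrightarrow> T' (w, e)) (at (w, e))" for w
    unfolding T'_def using sigma_pos by (intro tendsto_wald tendsto_intros) (simp add: e_def)

  have rep1: "W1 n \<omega> = w' (Z n \<omega>, E n \<omega>)" for n \<omega>
    by (simp add: W1_def w'_def E_def Z_def \<Delta>_def las_def algebra_simps)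
  have d'n: "d' (Z n \<omega>, E n \<omega>) = H *v W1 n \<omega> + \<xi>" for n \<omega>
    unfolding d'_def rep1 ..
  have u'n: "u' (Z n \<omega>, E n \<omega>) = B n *v (H *v W1 n \<omega> + \<xi>)" for n \<omega>
    unfolding u'_def d'n by (simp add: E_def)
  have T'n: "T' (Z n \<omega>, E n \<omega>) = wald H \<xi> (K n) (s2 n \<omega>) (Z n \<omega>)" for n \<omega>
    by (simp add: T'_def E_def)
  have \<kappa>'n: "\<kappa>' (Z n \<omega>, E n \<omega>) = \<kappa> n" for n \<omega>
    by (simp add: \<kappa>'_def E_def)
  define SSL where "SSL n \<omega> = sqrt (real n) *\<^sub>R (stein_lasso n (X n) (Y n \<omega>) (lam n) H h - \<beta> n)" for n \<omega>
  define PSSL where "PSSL n \<omega> = sqrt (real n) *\<^sub>R (pos_stein_lasso n (X n) (Y n \<omega>) (lam n) H h - \<beta> n)" for n \<omega>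
  have rep: "W4 n \<omega> = d' (Z n \<omega>, E n \<omega>)"
      "W2 n \<omega> = w' (Z n \<omega>, E n \<omega>) - u' (Z n \<omega>, E n \<omega>)"
      "W3 n \<omega> = u' (Z n \<omega>, E n \<omega>)"
      "SSL n \<omega> = w' (Z n \<omega>, E n \<omega>) - (\<kappa>' (Z n \<omega>, E n \<omega>) / T' (Z n \<omega>, E n \<omega>)) *\<^sub>R u' (Z n \<omega>, E n \<omega>)"
      "PSSL n \<omega> = w' (Z n \<omega>, E n \<omega>) - u' (Z n \<omega>, E n \<omega>)
         + ((1 - \<kappa>' (Z n \<omega>, E n \<omega>) / T' (Z n \<omega>, E n \<omega>))
              * of_bool (T' (Z n \<omega>, E n \<omega>) > \<kappa>' (Z n \<omega>, E n \<omega>))) *\<^sub>R u' (Z n \<omega>, E n \<omega>)"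
    if n: "n > p" for n \<omega>
    unfolding u'n T'n \<kappa>'n d'n rep1[symmetric]
    unfolding W2_def W3_def W4_def SSL_def PSSL_def \<kappa>_def
      W1_def s2_def Z_def ols'_def B_def K_def S_def
    by (rule estimators_in_local_coordinates[OF pG[OF n] n1[OF n] rank_H local_alt[OF n1[OF n]]])+

  have mW1: "W1 n \<in> borel_measurable (M n)" if "n > p" for n
    unfolding W1_def las_def[symmetric] using mlas[OF that] by measurable
  have md: "(\<lambda>\<omega>. d' (Z n \<omega>, E n \<omega>)) \<in> borel_measurable (M n)" if "n > p" for n
    unfolding d'n using mW1[OF that] by measurable
  have mu: "(\<lambda>\<omega>. u' (Z n \<omega>, E n \<omega>)) \<in> borel_measurable (M n)" if "n > p" for n
    unfolding u'n using mW1[OF that] by measurable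
  have mT: "(\<lambda>\<omega>. T' (Z n \<omega>, E n \<omega>)) \<in> borel_measurable (M n)" for n
    unfolding T'n wald_def using mZ[of n] by measurable
  have m4: "W4 n \<in> borel_measurable (M n)" if n: "n > p" for n
    using md[OF n] rep(1)[OF n] by (simp cong: measurable_cong)
  have m2: "W2 n \<in> borel_measurable (M n)" if n: "n > p" for n
    using borel_measurable_diff[OF mW1[OF n] mu[OF n]] unfolding rep1 by (simp add: rep(2)[OF n] cong: measurable_cong)
  have m3: "W3 n \<in> borel_measurable (M n)" if n: "n > p" for n
    using mu[OF n] rep(3)[OF n] by (simp cong: measurable_cong)

  have c_ols: "conv_in_dist M (\<lambda>n \<omega>. sqrt (real n) *\<^sub>R (ols n (X n) (Y n \<omega>) - \<beta> n)) W"
    using Z_conv unfolding Z_def ols'_def .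
  have limit_cont: "conv_in_dist M V (distr W borel (\<lambda>w. F (w, e)))"
    if "\<And>n. n > p \<Longrightarrow> V n \<in> borel_measurable (M n)"
      and "\<And>n \<omega>. n > p \<Longrightarrow> V n \<omega> = F (Z n \<omega>, E n \<omega>)"
      and cont: "\<And>w. (F \<longlongrightarrow> F (w, e)) (at (w, e))"
      and "(\<lambda>w. F (w, e)) \<in> borel_measurable borel"
    for V :: "nat \<Rightarrow> 'w \<Rightarrow> 'c::euclidean_space" and F
  proof (rule limit[OF that(1) that(2) _ that(4)])
    show "AE w in W. isCont F (w, e) \<and> F (w, e) = F (w, e)"
      unfolding isCont_def by (intro AE_I2 conjI refl cont)
  qed
  have normal: "conv_normal M V \<mu> T"
    if "normal_law \<mu> T (distr W borel (\<lambda>w. F (w, e)))"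
      and "\<And>n. n > p \<Longrightarrow> V n \<in> borel_measurable (M n)"
      and "\<And>n \<omega>. n > p \<Longrightarrow> V n \<omega> = F (Z n \<omega>, E n \<omega>)"
      and "\<And>w. (F \<longlongrightarrow> F (w, e)) (at (w, e))"
      and "(\<lambda>w. F (w, e)) \<in> borel_measurable borel"
    for V :: "nat \<Rightarrow> 'w \<Rightarrow> real^'d" and F \<mu> T
    unfolding conv_normal_def using that(1) limit_cont[OF that(2-5)] by blast
  have "conv_in_dist M W1 (distr W borel (\<lambda>w. w' (w, e)))"
    by (rule limit_cont[OF mW1 rep1 tw]) (simp_all add: at_e)
  then have c1: "conv_in_dist M W1 W"
    using DW(3) by (simp add: at_e distr_id2)
  have scale: "P ** (\<sigma>\<^sup>2 *\<^sub>R ?Ci) ** R = \<sigma>\<^sup>2 *\<^sub>R (P ** ?Ci ** R)"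
    for P :: "real^'p^'r" and R :: "real^'s^'p"
    by (simp add: matrix_scalar_ac scalar_matrix_assoc[symmetric])
  have tR: "transpose (mat 1 - Q) = mat 1 - transpose Q"
    by (simp add: vec_eq_iff transpose_def mat_def eq_commute)
  have RC: "(mat 1 - Q) ** ?Ci = A"
    unfolding A by (simp add: matrix_diff_mult)
  have AQ: "A ** transpose Q = 0"
    unfolding A matrix_diff_mult QC by simp
  have RR: "(mat 1 - Q) ** ?Ci ** transpose (mat 1 - Q) = A"
    unfolding RC tR by (simp add: matrix_diff_mult AQ)
  have RQ: "(mat 1 - Q) ** ?Ci ** transpose Q = 0"
    unfolding RC AQ ..
  have QR: "Q ** ?Ci ** transpose (mat 1 - Q) = 0"
    unfolding tR by (simp add: matrix_diff_mult QC)
  have tH: "transpose (mat 1) = (mat 1 :: real^'p^'p)" by (rule transpose_mat)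

  have w_sub: "w - (Q *v w + \<delta>) = (mat 1 - Q) *v w + - \<delta>" for w
    by (simp add: matrix_vector_mult_diff_rdistrib)
  have c2: "conv_normal M W2 (- \<delta>) (\<sigma>\<^sup>2 *\<^sub>R A)"
  proof (rule normal[of _ _ "\<lambda>u. w' u - u' u"])
    show "normal_law (- \<delta>) (\<sigma>\<^sup>2 *\<^sub>R A) (distr W borel (\<lambda>w. w' (w, e) - u' (w, e)))"
      using normal_law_matrix_image[OF W, of "mat 1 - Q" "- \<delta>"]
      unfolding at_e scale RR w_sub by simp
    show "(\<lambda>w. w' (w, e) - u' (w, e)) \<in> borel_measurable borel" unfolding at_e by measurable
  qed (rule m2 rep(2) tendsto_diff tw tu | assumption)+
  have c3: "conv_normal M W3 \<delta> (\<sigma>\<^sup>2 *\<^sub>R (?Ci - A))"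
  proof (rule normal[of _ _ u'])
    show "normal_law \<delta> (\<sigma>\<^sup>2 *\<^sub>R (?Ci - A)) (distr W borel (\<lambda>w. u' (w, e)))"
      using normal_law_matrix_image[OF W, of Q \<delta>] unfolding at_e scale QC CA by simp
    show "(\<lambda>w. u' (w, e)) \<in> borel_measurable borel" unfolding at_e by measurable
  qed (rule m3 rep(3) tu | assumption)+
  have c4: "conv_normal M W4 \<xi> (\<sigma>\<^sup>2 *\<^sub>R (H ** ?Ci ** transpose H))"
  proof (rule normal[of _ _ d'])
    show "normal_law \<xi> (\<sigma>\<^sup>2 *\<^sub>R (H ** ?Ci ** transpose H)) (distr W borel (\<lambda>w. d' (w, e)))"
      using normal_law_matrix_image[OF W, of H \<xi>] unfolding at_e scale by simp
    show "(\<lambda>w. d' (w, e)) \<in> borel_measurable borel" unfolding at_e by measurable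
  qed (rule m4 rep(1) td | assumption)+
  have c5: "conv_normal M (\<lambda>n \<omega>. block_vec (W1 n \<omega>) (W3 n \<omega>)) (block_vec 0 \<delta>)
        (\<sigma>\<^sup>2 *\<^sub>R block_mat ?Ci (?Ci - A) (?Ci - A) (?Ci - A))"
  proof (rule normal[of _ _ "\<lambda>u. block_vec (w' u) (u' u)"])
    show "normal_law (block_vec 0 \<delta>) (\<sigma>\<^sup>2 *\<^sub>R block_mat ?Ci (?Ci - A) (?Ci - A) (?Ci - A))
        (distr W borel (\<lambda>w. block_vec (w' (w, e)) (u' (w, e))))"
      using normal_law_block_image[OF W, of "mat 1" 0 Q \<delta>]
      unfolding at_e scale CA scaleR_block_mat tH QC by (simp add: QC)
    show "(\<lambda>w. block_vec (w' (w, e)) (u' (w, e))) \<in> borel_measurable borel" unfolding at_e by measurable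
  qed (rule borel_measurable_block_vec mW1 m3 tendsto_block_vec tw tu arg_cong2[where f = block_vec] rep1 rep(3) | assumption)+
  have c6: "conv_normal M (\<lambda>n \<omega>. block_vec (W2 n \<omega>) (W3 n \<omega>)) (block_vec (- \<delta>) \<delta>)
        (\<sigma>\<^sup>2 *\<^sub>R block_mat A 0 0 (?Ci - A))"
  proof (rule normal[of _ _ "\<lambda>u. block_vec (w' u - u' u) (u' u)"])
    show "normal_law (block_vec (- \<delta>) \<delta>) (\<sigma>\<^sup>2 *\<^sub>R block_mat A 0 0 (?Ci - A))
        (distr W borel (\<lambda>w. block_vec (w' (w, e) - u' (w, e)) (u' (w, e))))"
      using normal_law_block_image[OF W, of "mat 1 - Q" "- \<delta>" Q \<delta>]
      unfolding at_e scale CA scaleR_block_mat w_sub RR RQ QR QC by simp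
    show "(\<lambda>w. block_vec (w' (w, e) - u' (w, e)) (u' (w, e))) \<in> borel_measurable borel"
      unfolding at_e by measurable
  qed (rule borel_measurable_block_vec m2 m3 tendsto_block_vec tendsto_diff tw tu arg_cong2[where f = block_vec] rep(2,3) | assumption)+
  have c7: "conv_normal M (\<lambda>n \<omega>. block_vec (W1 n \<omega>) (W4 n \<omega>)) (block_vec 0 \<xi>)
        (\<sigma>\<^sup>2 *\<^sub>R block_mat ?Ci (?Ci ** transpose H) (H ** ?Ci) (H ** ?Ci ** transpose H))"
  proof (rule normal[of _ _ "\<lambda>u. block_vec (w' u) (d' u)"])
    show "normal_law (block_vec 0 \<xi>)
        (\<sigma>\<^sup>2 *\<^sub>R block_mat ?Ci (?Ci ** transpose H) (H ** ?Ci) (H ** ?Ci ** transpose H))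
        (distr W borel (\<lambda>w. block_vec (w' (w, e)) (d' (w, e))))"
      using normal_law_block_image[OF W, of "mat 1" 0 H \<xi>]
      unfolding at_e scale scaleR_block_mat tH by simp
    show "(\<lambda>w. block_vec (w' (w, e)) (d' (w, e))) \<in> borel_measurable borel" unfolding at_e by measurable
  qed (rule borel_measurable_block_vec mW1 m4 tendsto_block_vec tw td arg_cong2[where f = block_vec] rep1 rep(1) | assumption)+

  have LL_pos: "AE w in W. LL w > 0"
    using AE_normal_affine_nonzero[OF W pS rank_H, of \<xi>]
  proof eventually_elim
    case (elim w)
    then show ?case unfolding LL using sigma_pos by (intro wald_pos pK0) auto
  qed
  have LL_meas [measurable]: "LL \<in> borel_measurable borel"
    unfolding LL[abs_def] wald_def by measurable
  have c9: "conv_in_dist M SSL (distr W borel (\<lambda>w. w - k *\<^sub>R ((1 / LL w) *\<^sub>R (G *v (H *v w + \<xi>)))))"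
  proof (rule limit[of _ "\<lambda>u. w' u - (\<kappa>' u / T' u) *\<^sub>R u' u"])
    fix n assume n: "n > p"
    show "SSL n \<in> borel_measurable (M n)"
      unfolding rep(4)[OF n, abs_def] rep1[symmetric] \<kappa>'n using mu[OF n] mW1[OF n] mT[of n] by measurable
  next
    show "AE w in W. isCont (\<lambda>u. w' u - (\<kappa>' u / T' u) *\<^sub>R u' u) (w, e) \<and>
        w - k *\<^sub>R ((1 / LL w) *\<^sub>R (G *v (H *v w + \<xi>))) = w' (w, e) - (\<kappa>' (w, e) / T' (w, e)) *\<^sub>R u' (w, e)"
      using LL_pos
    proof eventually_elim
      case (elim w)
      then have "T' (w, e) \<noteq> 0" unfolding at_e by simp
      then have "isCont (\<lambda>u. w' u - (\<kappa>' u / T' u) *\<^sub>R u' u) (w, e)"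
        unfolding isCont_def by (intro tendsto_diff tendsto_scaleR tendsto_divide tw tu t\<kappa> tT)
      then show ?case unfolding at_e GH by simp
    qed
  qed (use rep(4) in auto)
  have c10: "conv_in_dist M PSSL
        (distr W borel (\<lambda>w. w - k *\<^sub>R ((1 / LL w) *\<^sub>R (G *v (H *v w + \<xi>)))
           - ((1 - k / LL w) * of_bool (LL w < k)) *\<^sub>R (G *v (H *v w + \<xi>))))"
  proof (rule limit[of _ "\<lambda>u. w' u - u' u + ((1 - \<kappa>' u / T' u) * of_bool (T' u > \<kappa>' u)) *\<^sub>R u' u"])
    fix n assume n: "n > p"
    show "PSSL n \<in> borel_measurable (M n)"
      unfolding rep(5)[OF n, abs_def] rep1[symmetric] \<kappa>'n using mu[OF n] mW1[OF n] mT[of n] by measurable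
  next
    show "AE w in W. isCont (\<lambda>u. w' u - u' u + ((1 - \<kappa>' u / T' u) * of_bool (T' u > \<kappa>' u)) *\<^sub>R u' u) (w, e) \<and>
        w - k *\<^sub>R ((1 / LL w) *\<^sub>R (G *v (H *v w + \<xi>)))
           - ((1 - k / LL w) * of_bool (LL w < k)) *\<^sub>R (G *v (H *v w + \<xi>))
        = w' (w, e) - u' (w, e) + ((1 - \<kappa>' (w, e) / T' (w, e)) * of_bool (T' (w, e) > \<kappa>' (w, e))) *\<^sub>R u' (w, e)"
      using LL_pos
    proof eventually_elim
      case (elim w)
      then have T: "T' (w, e) > 0" unfolding at_e .
      have "isCont (\<lambda>u. w' u - u' u + ((1 - \<kappa>' u / T' u) * of_bool (T' u > \<kappa>' u)) *\<^sub>R u' u) (w, e)"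
        unfolding isCont_def
        by (intro tendsto_add tendsto_diff tendsto_scaleR tw tu tendsto_positive_part_factor t\<kappa> tT T)
      moreover have "w - k *\<^sub>R ((1 / LL w) *\<^sub>R v) - ((1 - k / LL w) * of_bool (LL w < k)) *\<^sub>R v
          = w - v + ((1 - k / LL w) * of_bool (LL w > k)) *\<^sub>R v" for v
      proof -
        have "- (k / LL w) - (1 - k / LL w) * of_bool (LL w < k) = (1 - k / LL w) * of_bool (LL w > k) - 1"
          using elim by (cases "LL w = k") (auto simp: of_bool_def)
        then have "(- (k / LL w) - (1 - k / LL w) * of_bool (LL w < k)) *\<^sub>R v
            = ((1 - k / LL w) * of_bool (LL w > k) - 1) *\<^sub>R v" by simp
        then show ?thesis by (simp add: algebra_simps)
      qed
      ultimately show ?case unfolding at_e GH by blast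
    qed
  qed (use rep(5) in auto)
  show ?thesis
    using W c_ols c1 c2 c3 c4 c5 c6 c7 c9 c10 unfolding SSL_def PSSL_def by blast
qed

end
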